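(* Let $i\in\{3\frac{1}{2},4,5\}$. Let $X$ and $X'$ be locally connected locally compact $T_i$-spaces such that for every component $C$ of $X$ and every component $C'$ of $X'$ the Stone–Čech remainders $\beta C\setminus C$ and $\beta C'\setminus C'$ have cardinality at least $3$. If the partially ordered sets $(\mathscr{Y}_i(X),\leq)$ and $(\mathscr{Y}_i(X'),\leq)$ are order-isomorphic, then there is a bijection $C\mapsto C_\psi$ from the set of components of $X$ onto the set of components of $X'$ such that $\beta C\setminus C$ is homeomorphic to $\beta C_\psi\setminus C_\psi$ for every component $C$ of $X$. (That is, the order structure of $\mathscr{Y}_i(X)$ determines the faithfully indexed collection $\{\beta C\setminus C: C\text{ a component of }X\}$.)
   Context: Conventions: $T_{3\frac12}$ = completely regular and $T_1$; $T_4$ = normal and $T_1$; $T_5$ = hereditarily normal (every subspace normal) and $T_1$. $\beta C$ is the Stone–Čech compactification of $C$. A one-point connectification of $X$ is a connected space $Y$ containing $X$ as a dense subspace with $Y\setminus X$ a singleton; two are identified if there is a homeomorphism between them fixing every point of $X$. $\mathscr{Y}_i(X)$ is the set of (equivalence classes of) $T_i$ one-point connectifications of $X$, ordered by $Y_1\leq Y_2$ iff there is a continuous map $f:Y_2\to Y_1$ fixing every point of $X$. *)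

theory Defs
  imports "HOL-Analysis.Analysis"
begin

definition sep_Ti :: "real \<Rightarrow> 'a topology \<Rightarrow> bool" where
  "sep_Ti i X \<longleftrightarrow>
     (if i = 7/2 then completely_regular_space X \<and> t1_space X
      else if i = 4 then normal_space X \<and> t1_space X
      else if i = 5 then hereditarily normal_space X \<and> t1_space X
      else False)"

definition stone_cech :: "'a topology \<Rightarrow> 'b topology \<Rightarrow> ('a \<Rightarrow> 'b) \<Rightarrow> bool" where
  "stone_cech X K e \<longleftrightarrow>
     compact_space K \<and> Hausdorff_space K \<and> embedding_map X K e \<and>
     K closure_of (e ` topspace X) = topspace K \<and>
     (\<forall>f. continuous_map X euclideanreal f \<and> bounded (f ` topspace X) \<longrightarrow>
          (\<exists>g. continuous_map K euclideanreal g \<and> (\<forall>x\<in>topspace X. g (e x) = f x)))"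

definition remainder :: "'a topology \<Rightarrow> 'b topology \<Rightarrow> ('a \<Rightarrow> 'b) \<Rightarrow> 'b topology" where
  "remainder X K e = subtopology K (topspace K - e ` topspace X)"

text \<open>Representatives of one-point connectifications of X: topologies on 'a option
  with topspace Some ` topspace X plus the new point None, such that Some embeds X
  as a dense subspace, and the whole space is connected and T_i.  Every one-point
  connectification is equivalent (homeomorphic fixing X) to exactly one such
  topology, so this set is in bijection with the set of equivalence classes.\<close>
definition one_point_connectifications :: "real \<Rightarrow> 'a topology \<Rightarrow> 'a option topology set" where
  "one_point_connectifications i X =
     {Y. topspace Y = insert None (Some ` topspace X) \<and>
         embedding_map X Y Some \<and>
         Y closure_of (Some ` topspace X) = topspace Y \<and>
         connected_space Y \<and> sep_Ti i Y}"

definition conn_le :: "'a topology \<Rightarrow> 'a option topology \<Rightarrow> 'a option topology \<Rightarrow> bool" where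
  "conn_le X Y1 Y2 \<longleftrightarrow>
     (\<exists>f. continuous_map Y2 Y1 f \<and> (\<forall>x\<in>topspace X. f (Some x) = Some x))"

end

theory Submission
  imports Defs
begin

text \<open>
  For each of the three values of \<open>i\<close>, a \<open>T\<^sub>1\<close> extension of a \<open>T\<^sub>i\<close> space by one point is \<open>T\<^sub>i\<close> as soon as it is
  completely regular: regularity at the new point lets normality pass from \<open>X\<close> to the extension.
  Tychonoff one-point extensions of a locally compact \<open>X\<close> correspond, with reversed order, to the
  nonempty closed sets \<open>F \<subseteq> \<beta>X - X\<close>, and the extension is connected iff \<open>F\<close> meets the clopen piece
  \<open>cl C - X = \<beta>C - C\<close> of the remainder for every component \<open>C\<close>.  So the poset is the set of closed
  sets meeting every member of a disjoint clopen family.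

  Its minimal sets are the closures of choice functions \<open>x\<close>, and the value \<open>x C\<close> can be read off from
  the closure.  Two minimal sets have an upper bound containing no third minimal set iff their
  choice functions differ at exactly one component.  Fixing a base point \<open>x\<close>, the neighbours of \<open>x\<close> in
  this Hamming graph fall into one class per component, and the class of \<open>C\<close>, together with \<open>x\<close>, is
  a copy of \<open>\<beta>C - C\<close>, whose nonempty closed sets are exactly the nonempty traces of the sets below
  members \<open>H\<close> of the poset.
\<close>

section \<open>Recovering a disjoint clopen family from its transversal closed sets\<close>

definition transversal_sets :: "'c topology \<Rightarrow> 'i set \<Rightarrow> ('i \<Rightarrow> 'c set) \<Rightarrow> 'c set set" where
  "transversal_sets R I A = {F. closedin R F \<and> (\<forall>i\<in>I. F \<inter> A i \<noteq> {})}"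

definition minimal_in :: "'c set set \<Rightarrow> 'c set \<Rightarrow> bool" where
  "minimal_in L F \<longleftrightarrow> F \<in> L \<and> (\<forall>G\<in>L. G \<subseteq> F \<longrightarrow> G = F)"

definition twins :: "'c set set \<Rightarrow> 'c set \<Rightarrow> 'c set \<Rightarrow> bool" where
  "twins L F G \<longleftrightarrow> minimal_in L F \<and> minimal_in L G \<and> F \<noteq> G \<and>
     (\<exists>H\<in>L. F \<subseteq> H \<and> G \<subseteq> H \<and> (\<forall>E. minimal_in L E \<and> E \<subseteq> H \<longrightarrow> E = F \<or> E = G))"

locale clopen_family =
  fixes R :: "'c topology" and I :: "'i set" and A :: "'i \<Rightarrow> 'c set"
  assumes t1: "t1_space R"
    and open_A: "i \<in> I \<Longrightarrow> openin R (A i)"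
    and closed_A: "i \<in> I \<Longrightarrow> closedin R (A i)"
    and disjoint_A: "\<lbrakk>i \<in> I; j \<in> I; i \<noteq> j\<rbrakk> \<Longrightarrow> A i \<inter> A j = {}"
    and two_points: "i \<in> I \<Longrightarrow> \<exists>a\<in>A i. \<exists>b\<in>A i. a \<noteq> b"
begin

abbreviation L :: "'c set set" where "L \<equiv> transversal_sets R I A"

definition M :: "('i \<Rightarrow> 'c) \<Rightarrow> 'c set" where "M x = R closure_of (x ` I)"

lemma A_subset: "i \<in> I \<Longrightarrow> A i \<subseteq> topspace R"
  by (simp add: closed_A closedin_subset)

lemma closure_image_Int:
  assumes x: "x \<in> Pi I A" and "J \<subseteq> I" and i: "i \<in> I"
  shows "R closure_of (x ` J) \<inter> A i = x ` (J \<inter> {i})"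
proof -
  have sub: "x ` J \<subseteq> topspace R"
    using A_subset assms by (auto simp: Pi_iff subset_iff)
  have eq: "A i \<inter> x ` J = x ` (J \<inter> {i})"
  proof -
    have "k = i" if "k \<in> J" "x k \<in> A i" for k
      using that disjoint_A[of k i] assms by (auto simp: Pi_iff)
    then show ?thesis
      using x i by auto
  qed
  have "A i \<inter> R closure_of (x ` J) \<subseteq> R closure_of (A i \<inter> x ` J)"
    using openin_Int_closure_of_subset open_A[OF i] by metis
  also have "\<dots> = x ` (J \<inter> {i})"
  proof -
    have "finite (x ` (J \<inter> {i}))" "x ` (J \<inter> {i}) \<subseteq> topspace R"
      using sub by auto
    then show ?thesis
      unfolding eq using t1 by (simp add: closure_of_closedin t1_space_closedin_finite)
  qed
  finally have "A i \<inter> R closure_of (x ` J) \<subseteq> x ` (J \<inter> {i})" .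
  moreover have "x ` (J \<inter> {i}) \<subseteq> A i \<inter> R closure_of (x ` J)"
    unfolding eq[symmetric] using closure_of_subset[OF sub] by auto
  ultimately show ?thesis
    by (simp add: Int_commute subset_antisym)
qed

lemma M_Int: "\<lbrakk>x \<in> Pi I A; i \<in> I\<rbrakk> \<Longrightarrow> M x \<inter> A i = {x i}"
  using closure_image_Int[of x I i] by (auto simp: M_def)

lemma closedin_M: "closedin R (M x)"
  by (simp add: M_def)

lemma M_in_L: "x \<in> Pi I A \<Longrightarrow> M x \<in> L"
  using M_Int by (auto simp: transversal_sets_def M_def)

lemma M_subset_iff:
  assumes "x \<in> Pi I A" "closedin R H"
  shows "M x \<subseteq> H \<longleftrightarrow> (\<forall>i\<in>I. x i \<in> H)"
proof
  assume "M x \<subseteq> H" then show "\<forall>i\<in>I. x i \<in> H"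
    using M_Int assms by blast
next
  assume "\<forall>i\<in>I. x i \<in> H" then show "M x \<subseteq> H"
    unfolding M_def using assms by (intro closure_of_minimal) auto
qed

lemma M_mem_iff: "\<lbrakk>x \<in> Pi I A; y \<in> Pi I A; i \<in> I\<rbrakk> \<Longrightarrow> x i \<in> M y \<longleftrightarrow> x i = y i"
  using M_Int[of y i] by (auto simp: Pi_iff)

lemma M_subset_M: "\<lbrakk>x \<in> Pi I A; y \<in> Pi I A\<rbrakk> \<Longrightarrow> M x \<subseteq> M y \<longleftrightarrow> (\<forall>i\<in>I. x i = y i)"
  by (simp add: M_subset_iff closedin_M M_mem_iff)

lemma M_eq_iff: "\<lbrakk>x \<in> Pi I A; y \<in> Pi I A\<rbrakk> \<Longrightarrow> M x = M y \<longleftrightarrow> (\<forall>i\<in>I. x i = y i)"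
  by (metis M_subset_M subset_antisym order_refl)

lemma topspace_in_L: "topspace R \<in> L"
  using two_points A_subset by (fastforce simp: transversal_sets_def)

lemma L_contains_M:
  assumes "F \<in> L"
  obtains x where "x \<in> Pi I A" "M x \<subseteq> F"
proof -
  have F: "closedin R F" "\<forall>i\<in>I. \<exists>a. a \<in> F \<inter> A i"
    using assms by (auto simp: transversal_sets_def)
  then obtain x where x: "\<forall>i\<in>I. x i \<in> F \<inter> A i"
    by metis
  show thesis
    using x F by (intro that[of x]) (auto simp: M_subset_iff)
qed

lemma minimal_in_L: "minimal_in L F \<longleftrightarrow> (\<exists>x\<in>Pi I A. F = M x)"
proof
  assume "minimal_in L F"
  then show "\<exists>x\<in>Pi I A. F = M x"
    by (metis L_contains_M M_in_L minimal_in_def)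
next
  assume "\<exists>x\<in>Pi I A. F = M x"
  then obtain x where x: "x \<in> Pi I A" "F = M x" by blast
  show "minimal_in L F"
    unfolding minimal_in_def
  proof (intro conjI ballI impI)
    fix G assume "G \<in> L" "G \<subseteq> F"
    then obtain y where "y \<in> Pi I A" "M y \<subseteq> G"
      using L_contains_M by blast
    with x \<open>G \<subseteq> F\<close> show "G = F"
      by (metis M_eq_iff M_subset_M subset_antisym subset_trans)
  qed (simp add: x M_in_L)
qed

lemma minimal_in_M: "x \<in> Pi I A \<Longrightarrow> minimal_in L (M x)"
  by (auto simp: minimal_in_L)

lemma minimal_in_LE:
  assumes "minimal_in L F"
  obtains x where "x \<in> Pi I A" "F = M x"
  using assms by (auto simp: minimal_in_L)

lemma twins_M:
  assumes x: "x \<in> Pi I A" and y: "y \<in> Pi I A"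
  shows "twins L (M x) (M y) \<longleftrightarrow> (\<exists>i\<in>I. x i \<noteq> y i \<and> (\<forall>j\<in>I. j \<noteq> i \<longrightarrow> x j = y j))"
proof
  assume tw: "twins L (M x) (M y)"
  then obtain H where H: "H \<in> L" "M x \<subseteq> H" "M y \<subseteq> H"
      "\<forall>E. minimal_in L E \<and> E \<subseteq> H \<longrightarrow> E = M x \<or> E = M y" and ne: "M x \<noteq> M y"
    unfolding twins_def by (elim conjE bexE)
  then obtain i where i: "i \<in> I" "x i \<noteq> y i"
    using M_eq_iff[OF x y] by auto
  have clH: "closedin R H"
    using H by (simp add: transversal_sets_def)
  let ?z = "x(i := y i)"
  have z: "?z \<in> Pi I A"
    using x y by (auto simp: Pi_iff)
  have "M ?z \<subseteq> H"
    using H(2,3) x y z clH by (auto simp: M_subset_iff)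
  moreover have "minimal_in L (M ?z)"
    using z by (rule minimal_in_M)
  ultimately have "M ?z = M x \<or> M ?z = M y"
    using H(4) by simp
  then show "\<exists>i\<in>I. x i \<noteq> y i \<and> (\<forall>j\<in>I. j \<noteq> i \<longrightarrow> x j = y j)"
    using i x y z by (auto simp: M_eq_iff split: if_splits)
next
  assume "\<exists>i\<in>I. x i \<noteq> y i \<and> (\<forall>j\<in>I. j \<noteq> i \<longrightarrow> x j = y j)"
  then obtain i where i: "i \<in> I" "x i \<noteq> y i" "\<And>j. j \<in> I \<Longrightarrow> j \<noteq> i \<Longrightarrow> x j = y j"
    by blast
  let ?H = "M x \<union> M y"
  have "?H \<in> L"
    using M_in_L[OF x] M_in_L[OF y] by (auto simp: transversal_sets_def)
  moreover have "E = M x \<or> E = M y" if E: "minimal_in L E" "E \<subseteq> ?H" for E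
  proof -
    obtain z where z: "z \<in> Pi I A" "E = M z"
      using E(1) by (rule minimal_in_LE)
    have "z j \<in> M z" if "j \<in> I" for j
      using M_Int[OF z(1) that] by auto
    then have "\<forall>j\<in>I. z j \<in> M x \<union> M y"
      using E(2) z(2) by auto
    then have z_cases: "\<forall>j\<in>I. z j = x j \<or> z j = y j"
      using M_mem_iff[OF z(1) x] M_mem_iff[OF z(1) y] by auto
    have "\<forall>j\<in>I. z j = x j" if "z i = x i"
      using z_cases i(3) that by fastforce
    moreover have "\<forall>j\<in>I. z j = y j" if "z i = y i"
      using z_cases i(3) that by fastforce
    ultimately show ?thesis
      using z z_cases i(1) M_eq_iff[OF z(1) x] M_eq_iff[OF z(1) y] by blast
  qed
  moreover have "minimal_in L (M x)" "minimal_in L (M y)"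
    using x y by (auto intro: minimal_in_M)
  moreover have "M x \<noteq> M y"
    using i M_eq_iff[OF x y] by blast
  ultimately show "twins L (M x) (M y)"
    unfolding twins_def by (metis sup_ge1 sup_ge2)
qed

lemma upd_Pi: "\<lbrakk>x \<in> Pi I A; a \<in> A i\<rbrakk> \<Longrightarrow> x(i := a) \<in> Pi I A"
  by (auto simp: Pi_iff)

lemma M_upd_eq_iff:
  assumes "x \<in> Pi I A" "i \<in> I" "j \<in> I" "a \<in> A i" "b \<in> A j" "a \<noteq> x i"
  shows "M (x(i := a)) = M (x(j := b)) \<longleftrightarrow> i = j \<and> a = b"
  using assms M_eq_iff[of "x(i := a)" "x(j := b)"] by (auto simp: upd_Pi)

lemma closed_trace:
  assumes x: "x \<in> Pi I A" and i: "i \<in> I" and H: "H \<in> L" and y: "\<exists>y\<in>A i. M (x(i := y)) \<subseteq> H"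
  shows "closedin R {y\<in>A i. M (x(i := y)) \<subseteq> H}"
proof -
  have clH: "closedin R H"
    using H by (simp add: transversal_sets_def)
  have iff: "M (x(i := z)) \<subseteq> H \<longleftrightarrow> z \<in> H \<and> (\<forall>j\<in>I. j \<noteq> i \<longrightarrow> x j \<in> H)" if "z \<in> A i" for z
    using i M_subset_iff[OF upd_Pi[OF x that] clH] by auto
  then have "\<forall>j\<in>I. j \<noteq> i \<longrightarrow> x j \<in> H"
    using y by blast
  then have "{y\<in>A i. M (x(i := y)) \<subseteq> H} = H \<inter> A i"
    using iff by blast
  then show ?thesis
    using clH closed_A[OF i] by auto
qed

lemma trace_of_closed:
  assumes x: "x \<in> Pi I A" and i: "i \<in> I" and B: "closedin R B" "B \<subseteq> A i" "B \<noteq> {}"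
  obtains H where "H \<in> L" "{y\<in>A i. M (x(i := y)) \<subseteq> H} = B"
proof -
  let ?H = "B \<union> R closure_of (x ` (I - {i}))"
  have cl: "R closure_of (x ` (I - {i})) \<inter> A j = (if j = i then {} else {x j})" if "j \<in> I" for j
    using closure_image_Int[OF x, of "I - {i}" j] that by auto
  have H: "closedin R ?H"
    using B by auto
  have "?H \<inter> A j \<noteq> {}" if "j \<in> I" for j
    using cl[OF that] B by (auto split: if_splits)
  then have "?H \<in> L"
    using H by (auto simp: transversal_sets_def)
  moreover have "{y\<in>A i. M (x(i := y)) \<subseteq> ?H} = B"
  proof -
    have "M (x(i := y)) \<subseteq> ?H \<longleftrightarrow> y \<in> B" if "y \<in> A i" for y
    proof -
      have "y \<notin> R closure_of (x ` (I - {i}))"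
        using cl[OF i] that by auto
      moreover have "x j \<in> R closure_of (x ` (I - {i}))" if "j \<in> I" "j \<noteq> i" for j
        using cl[OF that(1)] that by auto
      ultimately show ?thesis
        using that x i H by (auto simp: M_subset_iff upd_Pi)
    qed
    then show ?thesis
      using B by blast
  qed
  ultimately show thesis
    by (rule that)
qed

end

lemma twins_order_iso:
  assumes \<phi>: "bij_betw \<phi> L L'"
    and mono: "\<And>F G. \<lbrakk>F \<in> L; G \<in> L\<rbrakk> \<Longrightarrow> \<phi> F \<subseteq> \<phi> G \<longleftrightarrow> F \<subseteq> G"
  shows "F \<in> L \<Longrightarrow> minimal_in L' (\<phi> F) \<longleftrightarrow> minimal_in L F"
    and "\<lbrakk>F \<in> L; G \<in> L\<rbrakk> \<Longrightarrow> twins L' (\<phi> F) (\<phi> G) \<longleftrightarrow> twins L F G"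
proof -
  have L': "L' = \<phi> ` L" and inj: "inj_on \<phi> L"
    using \<phi> by (auto simp: bij_betw_def)
  have eq: "\<phi> F = \<phi> G \<longleftrightarrow> F = G" if "F \<in> L" "G \<in> L" for F G
    using inj that by (auto simp: inj_on_def)
  show min: "minimal_in L' (\<phi> F) \<longleftrightarrow> minimal_in L F" if "F \<in> L" for F
    unfolding minimal_in_def L' using that by (auto simp: mono eq)
  have "(\<forall>E. minimal_in L' E \<and> E \<subseteq> \<phi> H \<longrightarrow> E = \<phi> F \<or> E = \<phi> G) \<longleftrightarrow>
        (\<forall>E. minimal_in L E \<and> E \<subseteq> H \<longrightarrow> E = F \<or> E = G)"
    if "F \<in> L" "G \<in> L" "H \<in> L" for F G H
  proof -
    have "(\<forall>E. minimal_in L' E \<and> E \<subseteq> \<phi> H \<longrightarrow> E = \<phi> F \<or> E = \<phi> G) \<longleftrightarrow>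
        (\<forall>E\<in>L'. minimal_in L' E \<and> E \<subseteq> \<phi> H \<longrightarrow> E = \<phi> F \<or> E = \<phi> G)"
      by (auto simp: minimal_in_def)
    also have "\<dots> \<longleftrightarrow> (\<forall>E\<in>L. minimal_in L E \<and> E \<subseteq> H \<longrightarrow> E = F \<or> E = G)"
      unfolding L' by (simp add: ball_simps min[unfolded L'] mono eq that)
    also have "\<dots> \<longleftrightarrow> (\<forall>E. minimal_in L E \<and> E \<subseteq> H \<longrightarrow> E = F \<or> E = G)"
      by (auto simp: minimal_in_def)
    finally show ?thesis .
  qed
  then show "twins L' (\<phi> F) (\<phi> G) \<longleftrightarrow> twins L F G" if "F \<in> L" "G \<in> L"
    unfolding twins_def using that by (auto simp: L' min[unfolded L'] mono eq)
qed

locale clopen_family_iso =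
  S: clopen_family R I A + T: clopen_family R' I' A'
  for R :: "'c topology" and I :: "'i set" and A and R' :: "'d topology" and I' :: "'j set" and A' +
  fixes \<phi> :: "'c set \<Rightarrow> 'd set" and x :: "'i \<Rightarrow> 'c" and x' :: "'j \<Rightarrow> 'd"
  assumes bij: "bij_betw \<phi> S.L T.L"
    and mono: "\<lbrakk>F \<in> S.L; G \<in> S.L\<rbrakk> \<Longrightarrow> \<phi> F \<subseteq> \<phi> G \<longleftrightarrow> F \<subseteq> G"
    and x: "x \<in> Pi I A" and x': "x' \<in> Pi I' A'"
    and base: "\<phi> (S.M x) = T.M x'"
begin

definition corr :: "'i \<Rightarrow> 'j \<Rightarrow> 'c \<Rightarrow> 'd \<Rightarrow> bool" where
  "corr i j y y' \<longleftrightarrow> y \<in> A i \<and> y' \<in> A' j \<and> \<phi> (S.M (x(i := y))) = T.M (x'(j := y'))"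

lemma upd_in_L: "y \<in> A i \<Longrightarrow> S.M (x(i := y)) \<in> S.L"
  by (simp add: S.M_in_L S.upd_Pi x)

lemma image_twin:
  assumes "i \<in> I" "y \<in> A i" "y \<noteq> x i"
  obtains j y' where "j \<in> I'" "y' \<noteq> x' j" "corr i j y y'"
proof -
  have tw: "twins S.L (S.M x) (S.M (x(i := y)))"
    using assms by (subst S.twins_M) (auto simp: x S.upd_Pi)
  then have tw': "twins T.L (T.M x') (\<phi> (S.M (x(i := y))))"
    using twins_order_iso(2)[OF bij mono] x assms
    by (metis S.M_in_L base upd_in_L)
  then obtain z where z: "z \<in> Pi I' A'" "\<phi> (S.M (x(i := y))) = T.M z"
    using T.minimal_in_L by (auto simp: twins_def)
  then obtain j where j: "j \<in> I'" "x' j \<noteq> z j" "\<forall>k\<in>I'. k \<noteq> j \<longrightarrow> x' k = z k"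
    using tw' T.twins_M[OF x' z(1)] by auto
  then have "T.M z = T.M (x'(j := z j))"
    using z by (subst T.M_eq_iff) (auto simp: T.upd_Pi x' Pi_iff)
  with j z assms show thesis
    by (intro that[of j "z j"]) (auto simp: corr_def Pi_iff)
qed

lemma corr_exists: 
  assumes i: "i \<in> I"
  shows "\<exists>j\<in>I'. \<forall>y\<in>A i. \<exists>y'. corr i j y y'"
proof -
  obtain a where a: "a \<in> A i" "a \<noteq> x i"
    using S.two_points[OF i] by metis
  obtain j a' where j: "j \<in> I'" "a' \<noteq> x' j" "corr i j a a'"
    using image_twin[OF i a] .
  have "\<exists>y'. corr i j y y'" if y: "y \<in> A i" for y
  proof (cases "y = x i \<or> y = a")
    case True
    then show ?thesis
    proof
      assume "y = x i"
      then have "corr i j y (x' j)"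
        using y base j x' by (auto simp: corr_def Pi_iff)
      then show ?thesis ..
    qed (use j in blast)
  next
    case False
    then obtain k y' where k: "k \<in> I'" "y' \<noteq> x' k" "corr i k y y'"
      using image_twin[OF i y] by metis
    have "twins S.L (S.M (x(i := a))) (S.M (x(i := y)))"
      using False a y i by (subst S.twins_M) (auto simp: S.upd_Pi x)
    then have "twins T.L (\<phi> (S.M (x(i := a)))) (\<phi> (S.M (x(i := y))))"
      using twins_order_iso(2)[OF bij mono] upd_in_L a y by metis
    then have "twins T.L (T.M (x'(j := a'))) (T.M (x'(k := y')))"
      using j k by (simp add: corr_def)
    then obtain l where "(x'(j := a')) l \<noteq> (x'(k := y')) l"
        "\<forall>m\<in>I'. m \<noteq> l \<longrightarrow> (x'(j := a')) m = (x'(k := y')) m"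
      using j k x' by (subst (asm) T.twins_M) (auto simp: T.upd_Pi corr_def)
    then have "k = j"
      using j k by (metis fun_upd_apply)
    then show ?thesis
      using k by blast
  qed
  with j show ?thesis by blast
qed

lemma closedin_corr:
  assumes i: "i \<in> I" and j: "j \<in> I'" and h: "\<And>y. y \<in> A i \<Longrightarrow> corr i j y (h y)"
    and surj: "h ` A i = A' j"
    and B: "closedin (subtopology R' (A' j)) B"
  shows "closedin (subtopology R (A i)) {y \<in> A i. h y \<in> B}"
proof (cases "B = {}")
  case False
  have B': "closedin R' B" "B \<subseteq> A' j"
    using B T.closed_A[OF j] closedin_closed_subtopology by blast+
  obtain H' where H': "H' \<in> T.L" "{y\<in>A' j. T.M (x'(j := y)) \<subseteq> H'} = B"
    using T.trace_of_closed[OF x' j B' False] .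
  obtain H where H: "H \<in> S.L" "H' = \<phi> H"
    using H'(1) bij by (auto simp: bij_betw_def)
  have iff: "h y \<in> B \<longleftrightarrow> S.M (x(i := y)) \<subseteq> H" if y: "y \<in> A i" for y
  proof -
    have "h y \<in> B \<longleftrightarrow> T.M (x'(j := h y)) \<subseteq> H'"
      using H'(2) h[OF y] by (auto simp: corr_def)
    also have "\<dots> \<longleftrightarrow> \<phi> (S.M (x(i := y))) \<subseteq> \<phi> H"
      using h[OF y] H by (auto simp: corr_def)
    finally show ?thesis
      using mono[OF upd_in_L[OF y] H(1)] by simp
  qed
  obtain y where "y \<in> A i" "h y \<in> B"
    using False B'(2) surj by (metis ex_in_conv imageE subsetD)
  then have "\<exists>y\<in>A i. S.M (x(i := y)) \<subseteq> H"
    using iff by metis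
  then have "closedin R {y\<in>A i. S.M (x(i := y)) \<subseteq> H}"
    by (rule S.closed_trace[OF x i H(1)])
  moreover have "{y\<in>A i. S.M (x(i := y)) \<subseteq> H} = {y\<in>A i. h y \<in> B}"
    by (rule Collect_cong) (metis iff)
  ultimately have "closedin R {y\<in>A i. h y \<in> B}"
    by simp
  then show ?thesis
    by (subst closedin_closed_subtopology[OF S.closed_A[OF i]]) auto
qed simp

end

lemma clopen_family_reconstruction:
  assumes "clopen_family R I A" "clopen_family R' I' A'"
    and bij: "bij_betw \<phi> (transversal_sets R I A) (transversal_sets R' I' A')"
    and mono: "\<And>F G. \<lbrakk>F \<in> transversal_sets R I A; G \<in> transversal_sets R I A\<rbrakk>
                 \<Longrightarrow> \<phi> F \<subseteq> \<phi> G \<longleftrightarrow> F \<subseteq> G"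
  obtains \<psi> where "bij_betw \<psi> I I'"
    "\<And>i. i \<in> I \<Longrightarrow> subtopology R (A i) homeomorphic_space subtopology R' (A' (\<psi> i))"
proof -
  interpret S: clopen_family R I A by fact
  interpret T: clopen_family R' I' A' by fact
  define \<phi>' where "\<phi>' = inv_into S.L \<phi>"
  have bij': "bij_betw \<phi>' T.L S.L"
    unfolding \<phi>'_def using bij by (rule bij_betw_inv_into)
  have inv: "\<phi> (\<phi>' G) = G" if "G \<in> T.L" for G
    unfolding \<phi>'_def using bij_betw_inv_into_right[OF bij that] .
  have inv': "\<phi>' (\<phi> F) = F" if "F \<in> S.L" for F
    unfolding \<phi>'_def using bij_betw_inv_into_left[OF bij that] .
  have mono': "\<phi>' F \<subseteq> \<phi>' G \<longleftrightarrow> F \<subseteq> G" if "F \<in> T.L" "G \<in> T.L" for F G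
    using that mono bij' inv by (metis bij_betwE)
  have "\<forall>i\<in>I. \<exists>a. a \<in> A i"
    using S.two_points by blast
  then obtain x where x: "x \<in> Pi I A"
    by (metis Pi_I)
  have "minimal_in T.L (\<phi> (S.M x))"
    by (simp add: twins_order_iso(1)[OF bij mono S.M_in_L[OF x]] S.minimal_in_M[OF x])
  then obtain x' where x': "x' \<in> Pi I' A'" and base: "\<phi> (S.M x) = T.M x'"
    using T.minimal_in_LE by metis
  interpret P: clopen_family_iso R I A R' I' A' \<phi> x x'
    by unfold_locales (fact bij mono x x' base)+
  have base': "\<phi>' (T.M x') = S.M x"
    using base inv'[OF S.M_in_L[OF x]] by simp
  interpret Q: clopen_family_iso R' I' A' R I A \<phi>' x' x
    by unfold_locales (fact bij' mono' x x' base')+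
  have corr_sym: "Q.corr j i y' y \<longleftrightarrow> P.corr i j y y'" for i j y y'
    unfolding P.corr_def Q.corr_def by (metis P.upd_in_L Q.upd_in_L inv inv')
  obtain \<psi> where \<psi>: "\<And>i. i \<in> I \<Longrightarrow> \<psi> i \<in> I'" "\<And>i. i \<in> I \<Longrightarrow> \<forall>y\<in>A i. \<exists>y'. P.corr i (\<psi> i) y y'"
    using P.corr_exists by metis
  obtain \<theta> where \<theta>: "\<And>j. j \<in> I' \<Longrightarrow> \<theta> j \<in> I" "\<And>j. j \<in> I' \<Longrightarrow> \<forall>y'\<in>A' j. \<exists>y. P.corr (\<theta> j) j y y'"
    using Q.corr_exists corr_sym by metis
  have unique: "i = k \<and> (y = z)" 
    if "i \<in> I" "k \<in> I" "P.corr i j y y'" "P.corr k j z y'" "y \<noteq> x i \<or> i = k" for i k j y z y'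
  proof (cases "y = x i \<and> z = x k")
    case False
    have "S.M (x(i := y)) = S.M (x(k := z))"
      using that by (metis P.corr_def P.upd_in_L inv')
    then show ?thesis
      using that False S.M_upd_eq_iff[OF x] by (metis P.corr_def)
  qed (use that in auto)
  have unique': "j = k \<and> (y' = z')" 
    if "j \<in> I'" "k \<in> I'" "P.corr i j y y'" "P.corr i k y z'" "y' \<noteq> x' j \<or> j = k" for i k j y z' y'
  proof (cases "y' = x' j \<and> z' = x' k")
    case False
    have "T.M (x'(j := y')) = T.M (x'(k := z'))"
      using that by (metis P.corr_def)
    then show ?thesis
      using that False T.M_upd_eq_iff[OF x'] by (metis P.corr_def)
  qed (use that in auto)
  have \<theta>\<psi>: "\<theta> (\<psi> i) = i" if i: "i \<in> I" for i
  proof -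
    obtain y where y: "y \<in> A i" "y \<noteq> x i"
      using S.two_points[OF i] by metis
    then obtain y' where y': "P.corr i (\<psi> i) y y'"
      using \<psi> i by blast
    then obtain z where "P.corr (\<theta> (\<psi> i)) (\<psi> i) z y'"
      using \<theta>(2)[OF \<psi>(1)[OF i]] P.corr_def by blast
    then show ?thesis
      using unique y y' i \<theta> \<psi> by metis
  qed
  have \<psi>\<theta>: "\<psi> (\<theta> j) = j" if j: "j \<in> I'" for j
  proof -
    obtain y' where y': "y' \<in> A' j" "y' \<noteq> x' j"
      using T.two_points[OF j] by metis
    then obtain y where y: "P.corr (\<theta> j) j y y'"
      using \<theta> j by blast
    then obtain z' where "P.corr (\<theta> j) (\<psi> (\<theta> j)) y z'"
      using \<psi>(2)[OF \<theta>(1)[OF j]] P.corr_def by blast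
    then show ?thesis
      using unique' y y' j \<theta> \<psi> by metis
  qed
  show thesis
  proof
    show "bij_betw \<psi> I I'"
      by (rule bij_betwI[of _ _ _ \<theta>]) (use \<psi> \<theta> \<theta>\<psi> \<psi>\<theta> in auto)
    fix i assume i: "i \<in> I"
    let ?j = "\<psi> i"
    note j = \<psi>(1)[OF i]
    obtain h where h: "\<And>y. y \<in> A i \<Longrightarrow> P.corr i ?j y (h y)"
      using \<psi>(2)[OF i] by metis
    obtain k where k: "\<And>y'. y' \<in> A' ?j \<Longrightarrow> P.corr i ?j (k y') y'"
      using \<theta>(2)[OF j] \<theta>\<psi>[OF i] by metis
    have hA: "h y \<in> A' ?j" if "y \<in> A i" for y
      using h[OF that] by (simp add: P.corr_def)
    have kA: "k y \<in> A i" if "y \<in> A' ?j" for y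
      using k[OF that] by (simp add: P.corr_def)
    have kh: "k (h y) = y" if "y \<in> A i" for y
      using unique[OF i i h[OF that] k[OF hA[OF that]]] by simp
    have hk: "h (k y) = y" if "y \<in> A' ?j" for y
      using unique'[OF j j k[OF that] h[OF kA[OF that]]] by simp
    have hi: "h ` A i = A' ?j" and ki: "k ` A' ?j = A i"
      using hA kA kh hk by force+
    have top: "topspace (subtopology R (A i)) = A i" "topspace (subtopology R' (A' ?j)) = A' ?j"
      using S.A_subset[OF i] T.A_subset[OF j] by auto
    have "homeomorphic_maps (subtopology R (A i)) (subtopology R' (A' ?j)) h k"
      unfolding homeomorphic_maps_def
    proof (intro conjI)
      show "continuous_map (subtopology R (A i)) (subtopology R' (A' ?j)) h"
        unfolding continuous_map_closedin top
      proof (intro conjI allI impI)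
        show "h \<in> A i \<rightarrow> A' ?j" by (simp add: hA)
      qed (rule P.closedin_corr[OF i j h hi])
      show "continuous_map (subtopology R' (A' ?j)) (subtopology R (A i)) k"
        unfolding continuous_map_closedin top
      proof (intro conjI allI impI)
        show "k \<in> A' ?j \<rightarrow> A i" by (simp add: kA)
        have "Q.corr ?j i y (k y)" if "y \<in> A' ?j" for y
          using k[OF that] corr_sym by simp
        then show "closedin (subtopology R' (A' ?j)) {y \<in> A' ?j. k y \<in> B}"
          if "closedin (subtopology R (A i)) B" for B
          using Q.closedin_corr[OF j i _ ki that] by simp
      qed
    qed (use top kh hk in auto)
    then show "subtopology R (A i) homeomorphic_space subtopology R' (A' ?j)"
      unfolding homeomorphic_space_def by blast
  qed
qed

section \<open>One-point extensions\<close>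

lemma normal_space_add_point:
  assumes reg: "regular_space Y" and openp: "openin Y (topspace Y - {p})"
    and norm: "normal_space (subtopology Y (topspace Y - {p}))"
  shows "normal_space Y"
proof -
  let ?Z = "topspace Y - {p}"
  have main: "\<exists>U V. openin Y U \<and> openin Y V \<and> S \<subseteq> U \<and> T \<subseteq> V \<and> disjnt U V"
    if S: "closedin Y S" and T: "closedin Y T" and dis: "disjnt S T" and p: "p \<notin> T" for S T
  proof -
    have "closedin (subtopology Y ?Z) (?Z \<inter> S)" "closedin (subtopology Y ?Z) (?Z \<inter> T)"
      using S T by (auto simp: closedin_subtopology)
    moreover have "disjnt (?Z \<inter> S) (?Z \<inter> T)"
      using dis by (auto simp: disjnt_iff)
    ultimately obtain U V where UV: "openin (subtopology Y ?Z) U" "openin (subtopology Y ?Z) V"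
      "?Z \<inter> S \<subseteq> U" "?Z \<inter> T \<subseteq> V" "disjnt U V"
      using norm unfolding normal_space_def by metis
    then have oUV: "openin Y U" "openin Y V"
      using openp openin_trans_full by blast+
    have sub: "S \<subseteq> topspace Y" "T \<subseteq> topspace Y"
      using S T by (simp_all add: closedin_subset)
    show ?thesis
    proof (cases "p \<in> topspace Y")
      case True
      then obtain A B where AB: "openin Y A" "openin Y B" "p \<in> A" "T \<subseteq> B" "disjnt A B"
        using reg T p unfolding regular_space_def by (metis Diff_iff)
      have "S \<subseteq> U \<union> A" "T \<subseteq> V \<inter> B" "disjnt (U \<union> A) (V \<inter> B)"
        using UV AB sub p by (auto simp: disjnt_iff)
      then show ?thesis
        using oUV AB by (intro exI[of _ "U \<union> A"] exI[of _ "V \<inter> B"]) auto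
    next
      case False
      then have "S \<subseteq> U" "T \<subseteq> V"
        using UV sub by auto
      then show ?thesis
        using oUV UV(5) by blast
    qed
  qed
  show ?thesis
    unfolding normal_space_def
  proof (intro allI impI)
    fix S T assume ST: "closedin Y S \<and> closedin Y T \<and> disjnt S T"
    show "\<exists>U V. openin Y U \<and> openin Y V \<and> S \<subseteq> U \<and> T \<subseteq> V \<and> disjnt U V"
    proof (cases "p \<in> T")
      case True
      then have "p \<notin> S"
        using ST by (auto simp: disjnt_iff)
      then obtain U V where "openin Y U \<and> openin Y V \<and> T \<subseteq> U \<and> S \<subseteq> V \<and> disjnt U V"
        using main[of T S] ST disjnt_sym by blast
      then show ?thesis
        using disjnt_sym by blast
    qed (use main ST in blast)
  qed
qed

lemma sep_Ti_imp_completely_regular: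
  assumes "sep_Ti i Y"
  shows "completely_regular_space Y" "Hausdorff_space Y"
proof -
  have t1: "t1_space Y" and "completely_regular_space Y \<or> normal_space Y"
    using assms hereditarily_inc by (auto simp: sep_Ti_def split: if_splits)
  then show cr: "completely_regular_space Y"
    using normal_t1_imp_regular_space normal_imp_completely_regular_space by blast
  show "Hausdorff_space Y"
    using cr t1 completely_regular_imp_regular_space regular_t1_imp_Hausdorff_space by blast
qed

lemma sep_Ti_add_point:
  assumes i: "i \<in> {7/2, 4, 5}" and X: "sep_Ti i X"
    and emb: "embedding_map X Y Some" and top: "topspace Y = insert None (Some ` topspace X)"
    and cr: "completely_regular_space Y" and t1: "t1_space Y"
  shows "sep_Ti i Y"
proof -
  have img: "Some ` topspace X = topspace Y - {None}"
    using top by auto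
  have hom: "X homeomorphic_space subtopology Y (topspace Y - {None})"
    using embedding_map_imp_homeomorphic_space[OF emb] img by simp
  have reg: "regular_space Y"
    using cr by (rule completely_regular_imp_regular_space)
  have op: "openin Y (topspace Y - {None})"
    using t1 by (meson openin_topspace t1_space_openin_delete_alt)
  consider "i = 7/2" | "i = 4" | "i = 5"
    using i by auto
  then show ?thesis
  proof cases
    case 1
    then show ?thesis
      using cr t1 by (simp add: sep_Ti_def)
  next
    case 2
    then have "normal_space (subtopology Y (topspace Y - {None}))"
      using X hom homeomorphic_normal_space by (auto simp: sep_Ti_def)
    then have "normal_space Y"
      by (rule normal_space_add_point[OF reg op])
    then show ?thesis
      using 2 t1 by (simp add: sep_Ti_def)
  next
    case 3
    then have her: "hereditarily normal_space (subtopology Y (topspace Y - {None}))"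
      using X hom homeomorphic_hereditarily_normal_space by (auto simp: sep_Ti_def)
    have "normal_space (subtopology Y S)" if S: "S \<subseteq> topspace Y" for S
    proof (rule normal_space_add_point)
      have eq: "topspace (subtopology Y S) - {None} = S \<inter> (topspace Y - {None})"
        using S by auto
      show "regular_space (subtopology Y S)"
        using reg by (rule regular_space_subtopology)
      show "openin (subtopology Y S) (topspace (subtopology Y S) - {None})"
        unfolding eq by (metis Int_commute op openin_subtopology_Int)
      have "normal_space (subtopology (subtopology Y (topspace Y - {None})) S)"
        using her by (simp add: hereditarily)
      then show "normal_space (subtopology (subtopology Y S) (topspace (subtopology Y S) - {None}))"
        unfolding eq by (simp add: subtopology_subtopology Int_commute Int_left_commute)
    qed
    then show ?thesis
      using 3 t1 by (simp add: sep_Ti_def hereditarily_def)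
  qed
qed

lemma one_point_connectificationsD:
  assumes "Y \<in> one_point_connectifications i X"
  shows "topspace Y = insert None (Some ` topspace X)" "embedding_map X Y Some"
    "Y closure_of (Some ` topspace X) = topspace Y" "connected_space Y"
    "completely_regular_space Y" "Hausdorff_space Y"
  using assms sep_Ti_imp_completely_regular by (auto simp: one_point_connectifications_def)

lemma one_point_connectifications_empty:
  assumes "topspace X = {}"
  shows "one_point_connectifications i X = {}"
  using assms by (auto simp: one_point_connectifications_def)

lemma conn_le_iff:
  assumes Y1: "Y1 \<in> one_point_connectifications i X" and Y2: "Y2 \<in> one_point_connectifications i X"
  shows "conn_le X Y1 Y2 \<longleftrightarrow> (\<forall>U. openin Y1 U \<longrightarrow> openin Y2 U)"
proof
  note D1 = one_point_connectificationsD[OF Y1] and D2 = one_point_connectificationsD[OF Y2]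
  assume "conn_le X Y1 Y2"
  then obtain f where f: "continuous_map Y2 Y1 f" and fS: "\<And>x. x \<in> topspace X \<Longrightarrow> f (Some x) = Some x"
    by (auto simp: conn_le_def)
  have fN: "f None = None"
  proof (rule ccontr)
    assume "f None \<noteq> None"
    have "f \<in> topspace Y2 \<rightarrow> Some ` topspace X"
      using continuous_map_funspace[OF f] \<open>f None \<noteq> None\<close> fS D1(1) D2(1) by (auto simp: Pi_iff)
    then have f': "continuous_map Y2 (subtopology Y1 (Some ` topspace X)) f"
      using f by (simp add: continuous_map_in_subtopology)
    obtain g where g: "homeomorphic_maps X (subtopology Y1 (Some ` topspace X)) Some g"
      using D1(2) by (auto simp: embedding_map_def homeomorphic_map_maps)
    have "continuous_map X Y2 Some"
      using D2(2) by (auto simp: embedding_map_def dest!: homeomorphic_imp_continuous_map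
          intro: continuous_map_into_fulltopology)
    then have k: "continuous_map Y2 Y2 (Some \<circ> (g \<circ> f))"
      using f' g by (intro continuous_map_compose) (auto simp: homeomorphic_maps_def)
    have "(Some \<circ> (g \<circ> f)) None = id None"
    proof (rule forall_in_closure_of_eq[OF _ D2(6) k continuous_map_id])
      show "None \<in> Y2 closure_of (Some ` topspace X)"
        using D2 by simp
      show "(Some \<circ> (g \<circ> f)) y = id y" if "y \<in> Some ` topspace X" for y
        using that fS g by (auto simp: homeomorphic_maps_def)
    qed
    then show False by simp
  qed
  show "\<forall>U. openin Y1 U \<longrightarrow> openin Y2 U"
  proof (intro allI impI)
    fix U assume U: "openin Y1 U"
    have "{y \<in> topspace Y2. f y \<in> U} = U"
      using fS fN D1(1) D2(1) openin_subset[OF U] by auto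
    then show "openin Y2 U"
      using openin_continuous_map_preimage[OF f U] by simp
  qed
next
  note D1 = one_point_connectificationsD[OF Y1] and D2 = one_point_connectificationsD[OF Y2]
  assume U: "\<forall>U. openin Y1 U \<longrightarrow> openin Y2 U"
  have "continuous_map Y2 Y1 id"
    unfolding continuous_map
  proof (intro conjI allI impI)
    show "id ` topspace Y2 \<subseteq> topspace Y1"
      using D1(1) D2(1) by simp
    show "openin Y2 {x \<in> topspace Y2. id x \<in> V}" if "openin Y1 V" for V
    proof -
      have "openin Y2 V" using U that by blast
      moreover from openin_subset[OF this] have "{x \<in> topspace Y2. id x \<in> V} = V" by auto
      ultimately show ?thesis by simp
    qed
  qed
  then show "conn_le X Y1 Y2"
    unfolding conn_le_def by (intro exI[of _ id]) simp
qed

section \<open>One-point connectifications and closed subsets of the remainder\<close>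

lemma compact_space_directed_Inter:
  assumes K: "compact_space K" and D: "closedin K D" and ne: "\<N> \<noteq> {}"
    and cl: "\<And>U. U \<in> \<N> \<Longrightarrow> closedin K (c U)"
    and dir: "\<And>U V. \<lbrakk>U \<in> \<N>; V \<in> \<N>\<rbrakk> \<Longrightarrow> \<exists>W\<in>\<N>. c W \<subseteq> c U \<inter> c V"
    and meets: "\<And>U. U \<in> \<N> \<Longrightarrow> D \<inter> c U \<noteq> {}"
  shows "D \<inter> (\<Inter>U\<in>\<N>. c U) \<noteq> {}"
proof -
  let ?\<U> = "(\<lambda>U. D \<inter> c U) ` \<N>"
  have lower: "\<exists>W\<in>\<N>. \<forall>V\<in>\<V>. c W \<subseteq> c V" if "finite \<V>" "\<V> \<subseteq> \<N>" for \<V>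
    using that
  proof (induction \<V>)
    case empty
    then show ?case using ne by auto
  next
    case (insert V \<V>)
    then obtain U where U: "U \<in> \<N>" "\<forall>V\<in>\<V>. c U \<subseteq> c V" by auto
    moreover obtain W where "W \<in> \<N>" "c W \<subseteq> c U \<inter> c V"
      using dir[of U V] insert.prems U(1) by auto
    ultimately show ?case by (intro bexI[of _ W]) auto
  qed
  have "\<Inter>\<F> \<noteq> {}" if \<F>: "finite \<F>" "\<F> \<subseteq> ?\<U>" for \<F>
  proof -
    obtain \<V> where \<V>: "\<V> \<subseteq> \<N>" "finite \<V>" "\<F> = (\<lambda>U. D \<inter> c U) ` \<V>"
      using finite_subset_image[OF \<F>] by auto
    obtain W where W: "W \<in> \<N>" "\<forall>V\<in>\<V>. c W \<subseteq> c V"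
      using lower[OF \<V>(2,1)] by auto
    have "D \<inter> c W \<subseteq> \<Inter>\<F>"
      unfolding \<V>(3) using W(2) by auto
    then show ?thesis
      using meets[OF W(1)] by auto
  qed
  moreover have "\<forall>B\<in>?\<U>. closedin K B"
    using D cl by auto
  ultimately have "\<Inter>?\<U> \<noteq> {}"
    using K[unfolded compact_space_fip, THEN spec[of _ "?\<U>"]] by blast
  then show ?thesis
    using ne by auto
qed

locale stone_cech_compactification =
  fixes X :: "'a topology" and K :: "'c topology" and e :: "'a \<Rightarrow> 'c"
  assumes sc: "stone_cech X K e"
    and locally_compact: "locally_compact_space X"
    and locally_connected: "locally_connected_space X"
begin

lemma compact_K: "compact_space K" and Hausdorff_K: "Hausdorff_space K"
  and emb: "embedding_map X K e" and dense: "K closure_of (e ` topspace X) = topspace K"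
  using sc by (auto simp: stone_cech_def)

lemma bounded_extension:
  assumes "continuous_map X euclideanreal f" "bounded (f ` topspace X)"
  obtains g where "continuous_map K euclideanreal g" "\<And>x. x \<in> topspace X \<Longrightarrow> g (e x) = f x"
  using sc assms unfolding stone_cech_def by meson

lemma continuous_e: "continuous_map X K e"
  using emb by (auto simp: embedding_map_def dest!: homeomorphic_imp_continuous_map
      intro: continuous_map_into_fulltopology)

lemma inj_e: "inj_on e (topspace X)"
  using emb by (simp add: embedding_map_def homeomorphic_imp_injective_map)

lemma e_in: "x \<in> topspace X \<Longrightarrow> e x \<in> topspace K"
  using continuous_e by (auto simp: continuous_map_def)

lemma open_range: "openin K (e ` topspace X)"
proof (rule dense_locally_compact_openin_Hausdorff_space[OF Hausdorff_K _ dense])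
  show "e ` topspace X \<subseteq> topspace K"
    using e_in by blast
  show "locally_compact_space (subtopology K (e ` topspace X))"
    using embedding_map_imp_homeomorphic_space[OF emb] homeomorphic_locally_compact_space
      locally_compact by blast
qed

lemma open_image: "openin X U \<Longrightarrow> openin K (e ` U)"
proof -
  assume U: "openin X U"
  have "openin (subtopology K (e ` topspace X)) (e ` U)"
    using emb U openin_subset[OF U] unfolding embedding_map_def
    by (metis homeomorphic_map_openness)
  then show ?thesis
    using open_range openin_trans_full by blast
qed

lemma open_preimage: "openin K W \<Longrightarrow> openin X {x \<in> topspace X. e x \<in> W}"
  using continuous_e by (rule openin_continuous_map_preimage)

lemma dense_meets: "\<lbrakk>openin K W; z \<in> W\<rbrakk> \<Longrightarrow> \<exists>x\<in>topspace X. e x \<in> W"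
  using dense unfolding dense_intersects_open by blast

lemma completely_regular_K: "completely_regular_space K" and regular_K: "regular_space K"
  and t1_K: "t1_space K" and normal_K: "normal_space K"
  using compact_K Hausdorff_K compact_Hausdorff_or_regular_imp_normal_space Hausdorff_imp_t1_space
    normal_imp_completely_regular_space compact_Hausdorff_imp_regular_space by blast+

abbreviation corona :: "'a set \<Rightarrow> 'c set" where
  "corona C \<equiv> K closure_of (e ` C) - e ` topspace X"

abbreviation L :: "'c set set" where
  "L \<equiv> transversal_sets (remainder X K e) (connected_components_of X) corona"

lemma L_iff:
  "F \<in> L \<longleftrightarrow> closedin K F \<and> F \<inter> e ` topspace X = {} \<and>
     (\<forall>C\<in>connected_components_of X. F \<inter> K closure_of (e ` C) \<noteq> {})"
proof -
  have cl: "closedin K (topspace K - e ` topspace X)"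
    using open_range by blast
  have "closedin (remainder X K e) F \<longleftrightarrow> closedin K F \<and> F \<inter> e ` topspace X = {}"
    unfolding remainder_def closedin_closed_subtopology[OF cl]
    using closedin_subset by blast
  moreover have "F \<inter> corona C = F \<inter> K closure_of (e ` C)" if "F \<inter> e ` topspace X = {}" for C
    using that by blast
  ultimately show ?thesis
    unfolding transversal_sets_def mem_Collect_eq by (metis (no_types, lifting))
qed

text \<open>The neighbourhoods of the new point are the traces of the neighbourhoods of \<open>F\<close>:
  this is the subspace \<open>X \<union> {F}\<close> of the quotient of \<open>K\<close> that collapses \<open>F\<close> to a point.\<close>

definition ext :: "'c set \<Rightarrow> 'a option topology" where
  "ext F = topology (\<lambda>U. U \<subseteq> insert None (Some ` topspace X) \<and> openin X (Some -` U) \<and>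
     (None \<in> U \<longrightarrow> (\<exists>W. openin K W \<and> F \<subseteq> W \<and> (\<forall>x\<in>topspace X. e x \<in> W \<longrightarrow> Some x \<in> U))))"

lemma openin_ext:
  "openin (ext F) U \<longleftrightarrow> U \<subseteq> insert None (Some ` topspace X) \<and> openin X (Some -` U) \<and>
     (None \<in> U \<longrightarrow> (\<exists>W. openin K W \<and> F \<subseteq> W \<and> (\<forall>x\<in>topspace X. e x \<in> W \<longrightarrow> Some x \<in> U)))"
proof -
  let ?N = "\<lambda>U. \<exists>W. openin K W \<and> F \<subseteq> W \<and> (\<forall>x\<in>topspace X. e x \<in> W \<longrightarrow> Some x \<in> U)"
  have Int: "?N (S \<inter> T)" if S: "?N S" and T: "?N T" for S T
  proof -
    from S obtain W where "openin K W" "F \<subseteq> W" "\<forall>x\<in>topspace X. e x \<in> W \<longrightarrow> Some x \<in> S"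
      by blast
    moreover from T obtain W' where "openin K W'" "F \<subseteq> W'" "\<forall>x\<in>topspace X. e x \<in> W' \<longrightarrow> Some x \<in> T"
      by blast
    ultimately show ?thesis
      by (intro exI[of _ "W \<inter> W'"]) auto
  qed
  have Un: "?N (\<Union>\<U>)" if "U \<in> \<U>" "?N U" for U \<U>
    using that by blast
  have "istopology (\<lambda>U. U \<subseteq> insert None (Some ` topspace X) \<and> openin X (Some -` U) \<and> (None \<in> U \<longrightarrow> ?N U))"
    unfolding istopology_def
  proof (intro conjI allI impI)
    fix S T
    assume S: "S \<subseteq> insert None (Some ` topspace X) \<and> openin X (Some -` S) \<and> (None \<in> S \<longrightarrow> ?N S)"
      and T: "T \<subseteq> insert None (Some ` topspace X) \<and> openin X (Some -` T) \<and> (None \<in> T \<longrightarrow> ?N T)"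
    show "S \<inter> T \<subseteq> insert None (Some ` topspace X)"
      using S by blast
    show "openin X (Some -` (S \<inter> T))"
      using S T by (simp add: vimage_Int openin_Int)
    show "?N (S \<inter> T)" if "None \<in> S \<inter> T"
      using that S T by (intro Int) simp_all
  next
    fix \<U>
    assume U: "\<forall>U\<in>\<U>. U \<subseteq> insert None (Some ` topspace X) \<and> openin X (Some -` U) \<and> (None \<in> U \<longrightarrow> ?N U)"
    show "\<Union>\<U> \<subseteq> insert None (Some ` topspace X)"
      using conjunct1[OF bspec[OF U]] by (rule Union_least)
    show "openin X (Some -` \<Union>\<U>)"
      unfolding vimage_Union using conjunct1[OF conjunct2[OF bspec[OF U]]] by (intro openin_Union) auto
    show "?N (\<Union>\<U>)" if None: "None \<in> \<Union>\<U>"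
    proof -
      obtain V where "V \<in> \<U>" "None \<in> V"
        using None by blast
      then show ?thesis
        using conjunct2[OF conjunct2[OF bspec[OF U]]] by (intro Un[of V]) simp_all
    qed
  qed
  then show ?thesis
    unfolding ext_def by simp
qed

lemma topspace_ext:
  assumes "F \<subseteq> topspace K"
  shows "topspace (ext F) = insert None (Some ` topspace X)"
proof (rule subset_antisym)
  show "topspace (ext F) \<subseteq> insert None (Some ` topspace X)"
    using openin_topspace[of "ext F"] unfolding openin_ext by blast
  have "Some -` insert None (Some ` topspace X) = topspace X"
    by auto
  then have "openin (ext F) (insert None (Some ` topspace X))"
    unfolding openin_ext using assms by (auto intro!: exI[of _ "topspace K"])
  then show "insert None (Some ` topspace X) \<subseteq> topspace (ext F)"
    by (rule openin_subset)
qed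

lemma openin_ext_Some: "openin (ext F) (Some ` U) \<longleftrightarrow> openin X U"
proof -
  have "Some -` Some ` U = U"
    by auto
  then show ?thesis
    by (auto simp: openin_ext dest: openin_subset)
qed

lemma openin_ext_insert:
  assumes "openin K W" "F \<subseteq> W"
  shows "openin (ext F) (insert None (Some ` {x \<in> topspace X. e x \<in> W}))"
proof -
  have "Some -` insert None (Some ` {x \<in> topspace X. e x \<in> W}) = {x \<in> topspace X. e x \<in> W}"
    by auto
  then show ?thesis
    unfolding openin_ext using assms open_preimage by auto
qed

lemma continuous_map_ext:
  assumes F: "F \<subseteq> topspace K" and g: "continuous_map K euclideanreal g" and c: "\<And>z. z \<in> F \<Longrightarrow> g z = c"
  shows "continuous_map (ext F) euclideanreal (case_option c (g \<circ> e))"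
  unfolding continuous_map
proof (intro conjI allI impI)
  fix V :: "real set" assume V: "openin euclideanreal V"
  let ?W = "{z \<in> topspace K. g z \<in> V}"
  have W: "openin K ?W"
    using g V by (rule openin_continuous_map_preimage)
  have Some: "{x \<in> topspace X. e x \<in> ?W} = {x \<in> topspace X. g (e x) \<in> V}"
    using e_in by auto
  show "openin (ext F) {y \<in> topspace (ext F). (case y of None \<Rightarrow> c | Some x \<Rightarrow> (g \<circ> e) x) \<in> V}"
  proof (cases "c \<in> V")
    case True
    then have "{y \<in> topspace (ext F). (case y of None \<Rightarrow> c | Some x \<Rightarrow> (g \<circ> e) x) \<in> V} =
      insert None (Some ` {x \<in> topspace X. e x \<in> ?W})"
      unfolding Some topspace_ext[OF F] by auto
    moreover have "F \<subseteq> ?W"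
      using F c True by auto
    ultimately show ?thesis
      using openin_ext_insert[OF W] by simp
  next
    case False
    then have "{y \<in> topspace (ext F). (case y of None \<Rightarrow> c | Some x \<Rightarrow> (g \<circ> e) x) \<in> V} =
      Some ` {x \<in> topspace X. e x \<in> ?W}"
      unfolding Some topspace_ext[OF F] by auto
    then show ?thesis
      using open_preimage[OF W] openin_ext_Some by simp
  qed
qed simp

lemma t1_ext:
  assumes F: "F \<subseteq> topspace K" and dis: "F \<inter> e ` topspace X = {}"
  shows "t1_space (ext F)"
  unfolding t1_space_closedin_singleton
proof
  fix y assume y: "y \<in> topspace (ext F)"
  show "closedin (ext F) {y}"
  proof (cases y)
    case None
    have "topspace (ext F) - {y} = Some ` topspace X"
      using None topspace_ext[OF F] by auto
    then show ?thesis
      using y openin_ext_Some by (simp add: closedin_def)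
  next
    case (Some x)
    then have x: "x \<in> topspace X"
      using y topspace_ext[OF F] by auto
    have W: "openin K (topspace K - {e x})"
      using t1_K e_in[OF x] by (simp add: t1_space_closedin_singleton openin_diff)
    have "topspace (ext F) - {y} = insert None (Some ` {x' \<in> topspace X. e x' \<in> topspace K - {e x}})"
      using Some x topspace_ext[OF F] e_in inj_e by (auto simp: inj_on_def)
    moreover have "F \<subseteq> topspace K - {e x}"
      using F dis x by auto
    ultimately show ?thesis
      using y openin_ext_insert[OF W] by (simp add: closedin_def)
  qed
qed

lemma completely_regular_ext:
  assumes clF: "closedin K F" and dis: "F \<inter> e ` topspace X = {}"
  shows "completely_regular_space (ext F)"
  unfolding completely_regular_space_alt'
proof (intro allI impI)
  fix S y assume S: "openin (ext F) S" and y: "y \<in> S"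
  have F: "F \<subseteq> topspace K"
    using clF by (rule closedin_subset)
  have SX: "openin X (Some -` S)"
    using S by (simp add: openin_ext)
  show "\<exists>f. continuous_map (ext F) euclideanreal f \<and> f y = 0 \<and> f ` (topspace (ext F) - S) \<subseteq> {1}"
  proof (cases y)
    case None
    then obtain W where W: "openin K W" "F \<subseteq> W" "\<forall>x\<in>topspace X. e x \<in> W \<longrightarrow> Some x \<in> S"
      using S y by (auto simp: openin_ext)
    have "closedin K (topspace K - W)" "disjnt F (topspace K - W)"
      using W by (auto simp: disjnt_iff)
    then obtain g where g: "continuous_map K euclideanreal g" "g ` F \<subseteq> {0}" "g ` (topspace K - W) \<subseteq> {1}"
      using Urysohn_lemma_alt[OF normal_K clF] by metis
    have "continuous_map (ext F) euclideanreal (case_option 0 (g \<circ> e))"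
      using g by (intro continuous_map_ext[OF F]) auto
    moreover have "case_option 0 (g \<circ> e) ` (topspace (ext F) - S) \<subseteq> {1}"
    proof -
      have "g (e x) = 1" if "x \<in> topspace X" "Some x \<notin> S" for x
        using that W(3) g(3) e_in[OF that(1)] by (auto simp: image_subset_iff)
      then show ?thesis
        using y None by (auto simp: topspace_ext[OF F])
    qed
    ultimately show ?thesis
      using None by (intro exI[of _ "case_option 0 (g \<circ> e)"]) simp
  next
    case (Some x)
    let ?T = "topspace K - e ` (Some -` S)"
    have xS: "x \<in> Some -` S"
      using y Some by simp
    then have x: "x \<in> topspace X"
      using SX openin_subset by blast
    have T: "closedin K ?T"
      using open_image[OF SX] by blast
    have sub: "Some -` S \<subseteq> topspace X"
      using SX by (rule openin_subset)
    obtain g where g: "continuous_map K euclideanreal g" "g (e x) = 0" "g ` ?T \<subseteq> {1}"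
      using completely_regular_K T xS e_in[OF x] unfolding completely_regular_space_alt by blast
    have "F \<subseteq> ?T"
      using F dis sub by blast
    then have "continuous_map (ext F) euclideanreal (case_option 1 (g \<circ> e))"
      using g(3) by (intro continuous_map_ext[OF F g(1)]) blast
    moreover have "e x' \<in> ?T" if "x' \<in> topspace X" "Some x' \<notin> S" for x'
      using that e_in[OF that(1)] inj_on_image_mem_iff[OF inj_e that(1) sub] by simp
    then have "case_option 1 (g \<circ> e) ` (topspace (ext F) - S) \<subseteq> {1}"
      using g(3) unfolding topspace_ext[OF F] by (auto simp del: Diff_iff) (metis Diff_iff image_subset_iff singletonD)
    ultimately show ?thesis
      using Some g by (intro exI[of _ "case_option 1 (g \<circ> e)"]) simp
  qed
qed

lemma embedding_ext:
  assumes F: "F \<subseteq> topspace K"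
  shows "embedding_map X (ext F) Some"
proof (rule injective_open_imp_embedding_map)
  show "continuous_map X (ext F) Some"
    unfolding continuous_map
  proof (intro conjI allI impI)
    show "openin X {x \<in> topspace X. Some x \<in> U}" if "openin (ext F) U" for U
    proof -
      have U: "openin X (Some -` U)"
        using that by (simp add: openin_ext)
      moreover have "{x \<in> topspace X. Some x \<in> U} = Some -` U"
        using openin_subset[OF U] by auto
      ultimately show ?thesis by simp
    qed
  qed (auto simp: topspace_ext[OF F])
  show "open_map X (ext F) Some"
    by (simp add: open_map_def openin_ext_Some)
qed simp

lemma ext_dense:
  assumes F: "F \<subseteq> topspace K" "F \<noteq> {}"
  shows "ext F closure_of (Some ` topspace X) = topspace (ext F)"
  unfolding dense_intersects_open
proof (intro allI impI)
  fix T assume T: "openin (ext F) T \<and> T \<noteq> {}"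
  show "Some ` topspace X \<inter> T \<noteq> {}"
  proof (cases "None \<in> T")
    case True
    then obtain W where W: "openin K W" "F \<subseteq> W" "\<forall>x\<in>topspace X. e x \<in> W \<longrightarrow> Some x \<in> T"
      using T by (auto simp: openin_ext)
    obtain z where "z \<in> W"
      using F(2) W(2) by blast
    then obtain x where "x \<in> topspace X" "e x \<in> W"
      using dense_meets[OF W(1)] by blast
    then show ?thesis
      using W(3) by blast
  next
    case False
    moreover have "T \<subseteq> insert None (Some ` topspace X)" "T \<noteq> {}"
      using T by (simp_all add: openin_ext)
    ultimately show ?thesis
      by blast
  qed
qed

lemma connected_ext:
  assumes F: "F \<in> L"
  shows "connected_space (ext F)"
  unfolding connected_space_clopen_in
proof (intro allI impI)
  have Ftop: "F \<subseteq> topspace K"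
    using F closedin_subset by (auto simp: L_iff)
  have no_clopen: "V = {}" if V: "openin (ext F) V" "closedin (ext F) V" "None \<notin> V" for V
  proof (rule ccontr)
    assume "V \<noteq> {}"
    have oU: "openin (ext F) (topspace (ext F) - V)"
      using V by blast
    then have "closedin X (topspace X - Some -` (topspace (ext F) - V))"
      by (auto simp: openin_ext)
    moreover have "topspace X - Some -` (topspace (ext F) - V) = Some -` V"
      using V by (auto simp: topspace_ext[OF Ftop] openin_ext)
    ultimately have cl: "closedin X (Some -` V)" and op: "openin X (Some -` V)"
      using V by (auto simp: openin_ext)
    have "V \<subseteq> insert None (Some ` topspace X)"
      using V(1) by (simp add: openin_ext)
    then obtain x where x: "Some x \<in> V" "x \<in> topspace X"
      using \<open>V \<noteq> {}\<close> V(3) by blast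
    then obtain C where C: "C \<in> connected_components_of X" "x \<in> C"
      using Union_connected_components_of[of X] by (metis UnionE)
    have "C \<subseteq> Some -` V"
      using connectedin_clopen_cases[OF connectedin_connected_components_of[OF C(1)] cl op] C x
      by (auto simp: disjnt_iff)
    obtain W where W: "openin K W" "F \<subseteq> W" "\<forall>x\<in>topspace X. e x \<in> W \<longrightarrow> Some x \<in> topspace (ext F) - V"
      using oU V(3) topspace_ext[OF Ftop] by (auto simp: openin_ext)
    have "W \<inter> e ` C = {}"
      using W(3) \<open>C \<subseteq> Some -` V\<close> connected_components_of_subset[OF C(1)] by blast
    then have "W \<inter> K closure_of (e ` C) = {}"
      using W(1) by (simp add: openin_Int_closure_of_eq_empty)
    moreover have "F \<inter> K closure_of (e ` C) \<noteq> {}"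
      using F C(1) by (simp add: L_iff)
    ultimately show False
      using W(2) by blast
  qed
  fix T assume T: "openin (ext F) T \<and> closedin (ext F) T"
  show "T = {} \<or> T = topspace (ext F)"
  proof (cases "None \<in> T")
    case True
    have "topspace (ext F) - T = {}"
      using True T by (intro no_clopen) auto
    then show ?thesis
      using T closedin_subset by blast
  next
    case False
    then show ?thesis
      using no_clopen T by blast
  qed
qed

lemma ext_in:
  assumes i: "i \<in> {7/2, 4, 5}" and X: "sep_Ti i X" and ne: "topspace X \<noteq> {}" and F: "F \<in> L"
  shows "ext F \<in> one_point_connectifications i X"
proof -
  have clF: "closedin K F" and dis: "F \<inter> e ` topspace X = {}"
    and comp: "\<forall>C\<in>connected_components_of X. F \<inter> K closure_of (e ` C) \<noteq> {}"
    using F by (auto simp: L_iff)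
  have Ftop: "F \<subseteq> topspace K"
    using clF by (rule closedin_subset)
  obtain C where "C \<in> connected_components_of X"
    using ne Union_connected_components_of[of X] by (metis Sup_empty ex_in_conv)
  then have "F \<noteq> {}"
    using comp by blast
  have "sep_Ti i (ext F)"
    by (rule sep_Ti_add_point[OF i X embedding_ext[OF Ftop] topspace_ext[OF Ftop]
          completely_regular_ext[OF clF dis] t1_ext[OF Ftop dis]])
  then show ?thesis
    unfolding one_point_connectifications_def
    using embedding_ext[OF Ftop] topspace_ext[OF Ftop] ext_dense[OF Ftop \<open>F \<noteq> {}\<close>] connected_ext[OF F]
    by blast
qed

lemma ext_mono:
  assumes F: "closedin K F" and G: "closedin K G"
  shows "(\<forall>U. openin (ext G) U \<longrightarrow> openin (ext F) U) \<longleftrightarrow> F \<subseteq> G"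
proof
  assume "F \<subseteq> G"
  then show "\<forall>U. openin (ext G) U \<longrightarrow> openin (ext F) U"
    unfolding openin_ext by (meson subset_trans)
next
  assume U: "\<forall>U. openin (ext G) U \<longrightarrow> openin (ext F) U"
  show "F \<subseteq> G"
  proof (rule ccontr)
    assume "\<not> F \<subseteq> G"
    then obtain z where z: "z \<in> F" "z \<notin> G" by blast
    then have "z \<in> topspace K - G"
      using F closedin_subset by blast
    then obtain V W where VW: "openin K V" "openin K W" "z \<in> V" "G \<subseteq> W" "disjnt V W"
      using regular_K G unfolding regular_space_def by metis
    have "openin (ext F) (insert None (Some ` {x \<in> topspace X. e x \<in> W}))"
      using U openin_ext_insert[OF VW(2,4)] by blast
    moreover have "Some x \<in> insert None (Some ` {x \<in> topspace X. e x \<in> W}) \<longleftrightarrow> e x \<in> W"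
      if "x \<in> topspace X" for x
      using that by auto
    ultimately obtain W' where W': "openin K W'" "F \<subseteq> W'" "\<forall>x\<in>topspace X. e x \<in> W' \<longrightarrow> e x \<in> W"
      unfolding openin_ext by (metis insertI1)
    have "openin K (V \<inter> W')" "z \<in> V \<inter> W'"
      using VW W' z by auto
    from dense_meets[OF this] obtain x where "x \<in> topspace X" "e x \<in> V \<inter> W'"
      by blast
    then show False
      using W' VW(5) by (auto simp: disjnt_iff)
  qed
qed

lemma ext_surj:
  assumes Y: "Y \<in> one_point_connectifications i X"
  obtains F where "F \<in> L" "ext F = Y"
proof -
  note D = one_point_connectificationsD[OF Y]
  have t1: "t1_space Y"
    using D(6) by (rule Hausdorff_imp_t1_space)
  have img: "Some ` topspace X = topspace Y - {None}"
    using D(1) by auto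
  have oX: "openin Y (Some ` topspace X)"
    unfolding img using t1 by (meson openin_topspace t1_space_openin_delete_alt)
  have cont: "continuous_map X Y Some"
    using D(2) by (auto simp: embedding_map_def dest!: homeomorphic_imp_continuous_map
        intro: continuous_map_into_fulltopology)
  have oSome: "openin Y (Some ` U)" if "openin X U" for U
  proof -
    have "openin (subtopology Y (Some ` topspace X)) (Some ` U)"
      using D(2) that openin_subset[OF that] unfolding embedding_map_def
      by (metis homeomorphic_map_openness)
    then show ?thesis
      using oX openin_trans_full by blast
  qed
  define \<N> where "\<N> = {U. U \<subseteq> topspace X \<and> openin Y (insert None (Some ` U))}"
  have N_top: "topspace X \<in> \<N>"
    using D(1) openin_topspace[of Y] by (simp add: \<N>_def)
  have N_Int: "U \<inter> V \<in> \<N>" if "U \<in> \<N>" "V \<in> \<N>" for U V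
  proof -
    have "insert None (Some ` (U \<inter> V)) = insert None (Some ` U) \<inter> insert None (Some ` V)"
      by auto
    moreover have "openin Y (insert None (Some ` U) \<inter> insert None (Some ` V))"
      using that by (intro openin_Int) (simp_all add: \<N>_def)
    ultimately show ?thesis
      using that(1) by (auto simp: \<N>_def)
  qed
  have N_mono: "V \<in> \<N>" if "U \<in> \<N>" "U \<subseteq> V" "openin X V" for U V
  proof -
    have "insert None (Some ` V) = insert None (Some ` U) \<union> Some ` V"
      using that by auto
    moreover have "openin Y (insert None (Some ` U) \<union> Some ` V)"
      using that oSome[OF that(3)] by (intro openin_Un) (simp_all add: \<N>_def)
    ultimately show ?thesis
      using openin_subset[OF that(3)] by (simp add: \<N>_def)
  qed
  have N_comp: "U \<inter> C \<noteq> {}" if "U \<in> \<N>" "C \<in> connected_components_of X" for U C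
  proof
    assume emp: "U \<inter> C = {}"
    have "openin X C" "closedin X C"
      using that(2) locally_connected openin_connected_components_of_locally_connected_space
        closedin_connected_components_of by blast+
    then have "openin Y (Some ` C)" "openin Y (Some ` (topspace X - C))"
      by (auto intro: oSome)
    moreover have "topspace Y - Some ` C = insert None (Some ` U) \<union> Some ` (topspace X - C)"
      using emp that D(1) by (auto simp: \<N>_def)
    moreover have "openin Y (insert None (Some ` U))"
      using that(1) by (simp add: \<N>_def)
    ultimately have "openin Y (topspace Y - Some ` C)"
      by (metis openin_Un)
    moreover have "Some ` C \<subseteq> topspace Y"
      using \<open>openin Y (Some ` C)\<close> by (rule openin_subset)
    ultimately have "closedin Y (Some ` C)"
      by (simp add: closedin_def)
    then have "Some ` C = {} \<or> Some ` C = topspace Y"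
      using D(4) \<open>openin Y (Some ` C)\<close> unfolding connected_space_clopen_in by blast
    then show False
      using D(1) nonempty_connected_components_of[OF that(2)] by auto
  qed
  have N_ne: "\<N> \<noteq> {}"
    using N_top by auto
  have N_dir: "\<exists>W\<in>\<N>. K closure_of (e ` W) \<subseteq> K closure_of (e ` U) \<inter> K closure_of (e ` V)"
    if "U \<in> \<N>" "V \<in> \<N>" for U V
    using N_Int[OF that] by (intro bexI[of _ "U \<inter> V"] Int_greatest closure_of_mono image_mono) auto
  have in_closure: "e x \<in> K closure_of (e ` S)" if "x \<in> S" "S \<subseteq> topspace X" for x S
    using closure_of_subset[of "e ` S" K] e_in that by (auto simp: image_subset_iff)
  define F where "F = (\<Inter>U\<in>\<N>. K closure_of (e ` U))"
  have F_cl: "F \<subseteq> K closure_of (e ` U)" if "U \<in> \<N>" for U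
    using that by (auto simp: F_def)
  have clF: "closedin K F"
    unfolding F_def using N_top by (intro closedin_Inter) auto
  have comp: "F \<inter> K closure_of (e ` C) \<noteq> {}" if C: "C \<in> connected_components_of X" for C
  proof -
    have "K closure_of (e ` C) \<inter> (\<Inter>U\<in>\<N>. K closure_of (e ` U)) \<noteq> {}"
    proof (rule compact_space_directed_Inter[OF compact_K _ N_ne _ N_dir])
      fix U assume U: "U \<in> \<N>"
      obtain x where x: "x \<in> U" "x \<in> C"
        using N_comp[OF U C] by blast
      have "U \<subseteq> topspace X"
        using U by (simp add: \<N>_def)
      then show "K closure_of (e ` C) \<inter> K closure_of (e ` U) \<noteq> {}"
        using x in_closure[OF x(1)] in_closure[OF x(2)] connected_components_of_subset[OF C] by auto
    qed auto
    then show ?thesis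
      by (simp add: F_def Int_commute)
  qed
  have dis: "F \<inter> e ` topspace X = {}"
  proof -
    have "e x \<notin> F" if x: "x \<in> topspace X" for x
    proof -
      have "Some x \<in> topspace Y" "None \<in> topspace Y"
        using x D(1) by auto
      then obtain A B where AB: "openin Y A" "openin Y B" "Some x \<in> A" "None \<in> B" "disjnt A B"
        using D(6) unfolding Hausdorff_space_def by (metis option.distinct(1))
      let ?U = "{x \<in> topspace X. Some x \<in> B}" and ?V = "{x \<in> topspace X. Some x \<in> A}"
      have "insert None (Some ` ?U) = B"
        using AB(4) openin_subset[OF AB(2)] D(1) by auto
      then have U: "?U \<in> \<N>"
        using AB by (auto simp: \<N>_def)
      have "openin K (e ` ?V)"
        by (intro open_image openin_continuous_map_preimage[OF cont] AB)
      moreover have "e ` ?V \<inter> e ` ?U = {}"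
        using AB(5) inj_onD[OF inj_e] by (fastforce simp: disjnt_iff)
      ultimately have "e ` ?V \<inter> K closure_of (e ` ?U) = {}"
        by (simp add: openin_Int_closure_of_eq_empty)
      then show ?thesis
        using F_cl[OF U] x AB(3) by blast
    qed
    then show ?thesis by blast
  qed
  have FL: "F \<in> L"
    using clF dis comp by (simp add: L_iff)
  have Ftop: "F \<subseteq> topspace K"
    using clF by (rule closedin_subset)
  have nbhd: "(\<exists>W. openin K W \<and> F \<subseteq> W \<and> (\<forall>x\<in>topspace X. e x \<in> W \<longrightarrow> x \<in> U)) \<longleftrightarrow> U \<in> \<N>"
    if oU: "openin X U" for U
  proof
    assume "\<exists>W. openin K W \<and> F \<subseteq> W \<and> (\<forall>x\<in>topspace X. e x \<in> W \<longrightarrow> x \<in> U)"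
    then obtain W where W: "openin K W" "F \<subseteq> W" "\<forall>x\<in>topspace X. e x \<in> W \<longrightarrow> x \<in> U"
      by blast
    have "(topspace K - W) \<inter> (\<Inter>U\<in>\<N>. K closure_of (e ` U)) = {}"
      using W(2) by (auto simp: F_def)
    moreover have "(topspace K - W) \<inter> (\<Inter>U\<in>\<N>. K closure_of (e ` U)) \<noteq> {}"
      if "\<And>V. V \<in> \<N> \<Longrightarrow> (topspace K - W) \<inter> K closure_of (e ` V) \<noteq> {}"
      by (rule compact_space_directed_Inter[OF compact_K _ N_ne _ N_dir that]) (use W(1) in auto)
    ultimately obtain V where V: "V \<in> \<N>" "(topspace K - W) \<inter> K closure_of (e ` V) = {}"
      by metis
    have "x \<in> U" if x: "x \<in> V" for x
    proof -
      have "V \<subseteq> topspace X"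
        using V(1) by (simp add: \<N>_def)
      then have "x \<in> topspace X" "e x \<in> K closure_of (e ` V)"
        using in_closure x by auto
      then show ?thesis
        using V(2) W(3) e_in by blast
    qed
    then show "U \<in> \<N>"
      using N_mono[OF V(1)] oU by blast
  next
    assume U: "U \<in> \<N>"
    then have "openin Y (insert None (Some ` U))"
      by (simp add: \<N>_def)
    then have "closedin Y (topspace Y - insert None (Some ` U))" 
        "None \<in> topspace Y - (topspace Y - insert None (Some ` U))"
      using D(1) by (blast, simp)
    then obtain h where h: "continuous_map Y (top_of_set {0..1::real}) h" "h None = 0"
        "h ` (topspace Y - insert None (Some ` U)) \<subseteq> {1}"
      using D(5) unfolding completely_regular_space_def by metis
    have h_range: "h \<in> topspace Y \<rightarrow> {0..1}" and h_cont: "continuous_map Y euclideanreal h"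
      using h(1) by (auto simp: continuous_map_in_subtopology)
    have "continuous_map X euclideanreal (h \<circ> Some)"
      using cont h_cont by (rule continuous_map_compose)
    moreover have "(h \<circ> Some) ` topspace X \<subseteq> {0..1}"
      using h_range D(1) by auto
    then have "bounded ((h \<circ> Some) ` topspace X)"
      using bounded_closed_interval bounded_subset by blast
    ultimately obtain g where g: "continuous_map K euclideanreal g" "\<And>x. x \<in> topspace X \<Longrightarrow> g (e x) = h (Some x)"
      using bounded_extension by (metis comp_apply)
    let ?W = "{z \<in> topspace K. g z \<in> {..<1}}"
    have "openin K ?W"
      by (rule openin_continuous_map_preimage[OF g(1)]) simp
    moreover have "F \<subseteq> ?W"
    proof -
      let ?V = "{x \<in> topspace X. Some x \<in> {y \<in> topspace Y. h y \<in> {..<1/2}}}"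
      have "openin Y {y \<in> topspace Y. h y \<in> {..<1/2}}"
        by (rule openin_continuous_map_preimage[OF h_cont]) simp
      moreover have "insert None (Some ` ?V) = {y \<in> topspace Y. h y \<in> {..<1/2}}"
        using h(2) D(1) by auto
      ultimately have "?V \<in> \<N>"
        by (auto simp: \<N>_def)
      then have "F \<subseteq> K closure_of (e ` ?V)"
        by (rule F_cl)
      also have "\<dots> \<subseteq> {z \<in> topspace K. g z \<in> {..1/2}}"
      proof (rule closure_of_minimal)
        show "e ` ?V \<subseteq> {z \<in> topspace K. g z \<in> {..1/2}}"
          using g(2) e_in by auto
        show "closedin K {z \<in> topspace K. g z \<in> {..1/2}}"
          by (rule closedin_continuous_map_preimage[OF g(1)]) simp
      qed
      finally show ?thesis by auto
    qed
    moreover have "x \<in> U" if "x \<in> topspace X" "e x \<in> ?W" for x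
    proof (rule ccontr)
      assume "x \<notin> U"
      then have "h (Some x) = 1"
        using h(3) that(1) D(1) by auto
      then show False
        using that g(2) by auto
    qed
    ultimately show "\<exists>W. openin K W \<and> F \<subseteq> W \<and> (\<forall>x\<in>topspace X. e x \<in> W \<longrightarrow> x \<in> U)"
      by blast
  qed
  have "ext F = Y"
    unfolding topology_eq
  proof
    fix S :: "'a option set"
    have S_eq: "S = (if None \<in> S then insert None (Some ` (Some -` S)) else Some ` (Some -` S))"
      by (auto simp: image_vimage_eq) (metis not_None_eq rangeI)+
    have SX: "openin X (Some -` S)" if "openin Y S"
    proof -
      have "{x \<in> topspace X. Some x \<in> S} = Some -` S"
        using openin_subset[OF that] D(1) by auto
      then show ?thesis
        using openin_continuous_map_preimage[OF cont that] by simp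
    qed
    show "openin (ext F) S \<longleftrightarrow> openin Y S"
    proof (cases "None \<in> S")
      case True
      have S: "S = insert None (Some ` (Some -` S))"
        using S_eq True by simp
      have "openin (ext F) S \<longleftrightarrow> openin X (Some -` S) \<and> Some -` S \<in> \<N>"
      proof -
        have "S \<subseteq> insert None (Some ` topspace X)" if "openin X (Some -` S)"
          using openin_subset[OF that] by (subst S) auto
        then show ?thesis
          unfolding openin_ext using True nbhd[of "Some -` S"] by auto
      qed
      also have "\<dots> \<longleftrightarrow> openin Y S"
        using S SX openin_subset[of X "Some -` S"] by (auto simp: \<N>_def)
      finally show ?thesis .
    next
      case False
      then have S: "S = Some ` (Some -` S)"
        using S_eq by simp
      have "openin (ext F) S \<longleftrightarrow> openin X (Some -` S)"
        using openin_ext_Some[of F "Some -` S"] S by simp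
      also have "\<dots> \<longleftrightarrow> openin Y S"
        using S oSome[of "Some -` S"] SX by auto
      finally show ?thesis .
    qed
  qed
  with FL show thesis by (rule that)
qed

end

section \<open>Stone--Cech compactifications and components\<close>

lemma stone_cech_exists:
  assumes "completely_regular_space X" "Hausdorff_space X"
  obtains K :: "(('a \<Rightarrow> real) \<Rightarrow> real) topology" and e where "stone_cech (X :: 'a topology) K e"
proof -
  define J where "J = mspace (submetric (cfunspace X euclidean_metric) {f. f \<in> topspace X \<rightarrow> {0..1::real}})"
  define e where "e = (\<lambda>x. \<lambda>f\<in>J. f x)"
  define P where "P = product_topology (\<lambda>f. top_of_set {0..1::real}) J"
  define K where "K = subtopology P (P closure_of (e ` topspace X))"
  have emb: "embedding_map X P e"
    unfolding P_def e_def J_def by (rule completely_regular_space_cube_embedding_explicit[OF assms])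
  have "e ` topspace X \<subseteq> topspace P"
    using emb by (auto simp: embedding_map_def dest!: homeomorphic_imp_continuous_map
        simp: continuous_map_in_subtopology continuous_map_def)
  then have sub: "e ` topspace X \<subseteq> P closure_of (e ` topspace X)"
    by (rule closure_of_subset)
  have "compact_space P"
    unfolding P_def by (simp add: compact_space_product_topology compact_space_subtopology)
  then have "compact_space K"
    unfolding K_def by (simp add: closedin_compact_space compact_space_subtopology)
  moreover have "Hausdorff_space K"
    unfolding K_def P_def
    by (simp add: Hausdorff_space_subtopology Hausdorff_space_product_topology)
  moreover have "embedding_map X K e"
    unfolding K_def using emb sub by (simp add: embedding_map_in_subtopology)
  moreover have "K closure_of (e ` topspace X) = topspace K"
  proof -
    have "P closure_of (e ` topspace X) \<inter> e ` topspace X = e ` topspace X"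
      using sub by blast
    then show ?thesis
      unfolding K_def closure_of_subtopology
      using closure_of_subset_topspace[of P "e ` topspace X"] by auto
  qed
  moreover have "\<exists>g. continuous_map K euclideanreal g \<and> (\<forall>x\<in>topspace X. g (e x) = f x)"
    if f: "continuous_map X euclideanreal f" "bounded (f ` topspace X)" for f
  proof -
    obtain B where B: "B > 0" "\<And>x. x \<in> topspace X \<Longrightarrow> \<bar>f x\<bar> \<le> B"
      using f(2) unfolding bounded_pos by auto
    define h where "h = restrict (\<lambda>x. (f x + B) / (2 * B)) (topspace X)"
    have range: "h x \<in> {0..1}" if "x \<in> topspace X" for x
      using B(1) B(2)[OF that] that by (auto simp: h_def field_simps)
    have "continuous_map X euclideanreal (\<lambda>x. (f x + B) / (2 * B))"
      using f(1) B(1) by (intro continuous_intros) auto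
    then have "continuous_map X euclideanreal h"
      unfolding h_def by (rule continuous_map_eq) simp
    moreover have "h ` topspace X \<subseteq> {0..1}"
      using range by blast
    then have "bounded (h ` topspace X)"
      using bounded_closed_interval bounded_subset by blast
    ultimately have hJ: "h \<in> J"
      using range by (auto simp: J_def h_def)
    have "continuous_map P (top_of_set {0..1}) (\<lambda>z. z h)"
      unfolding P_def by (rule continuous_map_product_projection[OF hJ])
    then have "continuous_map K euclideanreal (\<lambda>z. z h)"
      unfolding K_def by (intro continuous_map_from_subtopology) (rule continuous_map_into_fulltopology)
    then have "continuous_map K euclideanreal (\<lambda>z. 2 * B * z h - B)"
      by (intro continuous_intros)
    moreover have "2 * B * e x h - B = f x" if "x \<in> topspace X" for x
      using hJ that B(1) by (simp add: e_def h_def field_simps)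
    ultimately show ?thesis by blast
  qed
  ultimately have "stone_cech X K e"
    unfolding stone_cech_def by blast
  then show thesis by (rule that)
qed

lemma stone_cech_lift:
  fixes K' :: "'d topology"
  assumes sc: "stone_cech X K e" and K': "compact_space K'" "Hausdorff_space K'"
    and f: "continuous_map X K' f"
  obtains h where "continuous_map K K' h" "\<And>x. x \<in> topspace X \<Longrightarrow> h (e x) = f x"
proof -
  have "completely_regular_space K'"
    using K' compact_Hausdorff_or_regular_imp_normal_space normal_imp_completely_regular_space by blast
  then obtain J :: "('d \<Rightarrow> real) set" and j
    where emb: "embedding_map K' (product_topology (\<lambda>\<phi>. top_of_set {0..1::real}) J) j"
    using completely_regular_space_cube_embedding[OF _ K'(2)] by blast
  define P where "P = product_topology (\<lambda>\<phi>. top_of_set {0..1::real}) J"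
  obtain j' where j': "homeomorphic_maps K' (subtopology P (j ` topspace K')) j j'"
    using emb by (auto simp: P_def embedding_map_def homeomorphic_map_maps)
  then have j: "continuous_map K' P j"
    by (auto simp: homeomorphic_maps_def continuous_map_in_subtopology)
  have f_in: "f x \<in> topspace K'" if "x \<in> topspace X" for x
    using f that by (auto simp: continuous_map_def)
  have j_in: "j y \<in> J \<rightarrow>\<^sub>E {0..1}" if "y \<in> topspace K'" for y
    using continuous_map_funspace[OF j] that by (auto simp: P_def)
  have "\<exists>g. continuous_map K (top_of_set {0..1}) g \<and> (\<forall>x\<in>topspace X. g (e x) = j (f x) \<phi>)"
    if \<phi>: "\<phi> \<in> J" for \<phi>
  proof -
    have range: "j (f x) \<phi> \<in> {0..1}" if "x \<in> topspace X" for x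
      using j_in[OF f_in[OF that]] \<phi> by (rule PiE_mem)
    have "continuous_map P (top_of_set {0..1}) (\<lambda>z. z \<phi>)"
      unfolding P_def by (rule continuous_map_product_projection[OF \<phi>])
    then have "continuous_map P euclideanreal (\<lambda>z. z \<phi>)"
      by (rule continuous_map_into_fulltopology)
    from continuous_map_compose[OF continuous_map_compose[OF f j] this]
    have "continuous_map X euclideanreal (\<lambda>x. j (f x) \<phi>)"
      by (simp add: o_def)
    moreover have "(\<lambda>x. j (f x) \<phi>) ` topspace X \<subseteq> {0..1}"
      using range by blast
    then have "bounded ((\<lambda>x. j (f x) \<phi>) ` topspace X)"
      using bounded_closed_interval bounded_subset by blast
    ultimately obtain g where g: "continuous_map K euclideanreal g" "\<forall>x\<in>topspace X. g (e x) = j (f x) \<phi>"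
      using sc unfolding stone_cech_def by meson
    have "continuous_map K (top_of_set {0..1}) (\<lambda>z. max 0 (min 1 (g z)))"
      unfolding continuous_map_in_subtopology
      using g(1) by (auto intro!: continuous_map_real_max continuous_map_real_min)
    moreover have "max 0 (min 1 (g (e x))) = j (f x) \<phi>" if "x \<in> topspace X" for x
      using g(2) that range[OF that] by simp
    ultimately show ?thesis by blast
  qed
  then obtain g where g: "\<And>\<phi>. \<phi> \<in> J \<Longrightarrow> continuous_map K (top_of_set {0..1}) (g \<phi>)"
    "\<And>\<phi> x. \<phi> \<in> J \<Longrightarrow> x \<in> topspace X \<Longrightarrow> g \<phi> (e x) = j (f x) \<phi>"
    by metis
  define h where "h = (\<lambda>z. \<lambda>\<phi>\<in>J. g \<phi> z)"
  have h: "continuous_map K P h"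
    unfolding P_def continuous_map_componentwise h_def using g(1) by auto
  have he: "h (e x) = j (f x)" if "x \<in> topspace X" for x
  proof
    show "h (e x) \<phi> = j (f x) \<phi>" for \<phi>
      using g(2)[OF _ that] PiE_arb[OF j_in[OF f_in[OF that]]] by (simp add: h_def)
  qed
  have Haus: "Hausdorff_space P"
    unfolding P_def by (simp add: Hausdorff_space_subtopology Hausdorff_space_product_topology)
  have "compactin P (j ` topspace K')"
    using K'(1) j by (intro image_compactin) (simp add: compact_space_def)
  then have cl: "closedin P (j ` topspace K')"
    by (rule compactin_imp_closedin[OF Haus])
  have "h z \<in> j ` topspace K'" if "z \<in> topspace K" for z
  proof (rule forall_in_closure_of[where P = "\<lambda>w. h w \<in> j ` topspace K'"])
    show "z \<in> K closure_of (e ` topspace X)"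
      using sc that by (simp add: stone_cech_def)
    show "h w \<in> j ` topspace K'" if "w \<in> e ` topspace X" for w
      using that he f_in by auto
    show "closedin K {z \<in> topspace K. h z \<in> j ` topspace K'}"
      using h cl by (rule closedin_continuous_map_preimage)
  qed
  then have "continuous_map K (subtopology P (j ` topspace K')) h"
    using h by (auto simp: continuous_map_in_subtopology)
  then have "continuous_map K K' (j' \<circ> h)"
    using j' continuous_map_compose by (auto simp: homeomorphic_maps_def)
  moreover have "(j' \<circ> h) (e x) = f x" if "x \<in> topspace X" for x
    using he[OF that] j' f_in[OF that] by (auto simp: homeomorphic_maps_def)
  ultimately show thesis by (rule that)
qed

lemma stone_cech_remainder_unique:
  assumes sc: "stone_cech X K e" and sc': "stone_cech X K' e'"
  shows "remainder X K e homeomorphic_space remainder X K' e'"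
proof -
  have cont: "continuous_map X K e" if "stone_cech X K e" for K :: "'z topology" and e
    using that by (auto simp: stone_cech_def embedding_map_def dest!: homeomorphic_imp_continuous_map
        intro: continuous_map_into_fulltopology)
  have H: "compact_space K" "Hausdorff_space K" "compact_space K'" "Hausdorff_space K'"
    and d: "K closure_of (e ` topspace X) = topspace K" "K' closure_of (e' ` topspace X) = topspace K'"
    using sc sc' by (auto simp: stone_cech_def)
  obtain h where h: "continuous_map K K' h" "\<And>x. x \<in> topspace X \<Longrightarrow> h (e x) = e' x"
    using stone_cech_lift[OF sc H(3,4) cont[OF sc']] by metis
  obtain k where k: "continuous_map K' K k" "\<And>x. x \<in> topspace X \<Longrightarrow> k (e' x) = e x"
    using stone_cech_lift[OF sc' H(1,2) cont[OF sc]] by metis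
  have kh: "k (h z) = z" if "z \<in> topspace K" for z
  proof -
    have "(k \<circ> h) z = id z"
      by (rule forall_in_closure_of_eq[OF _ H(2) continuous_map_compose[OF h(1) k(1)] continuous_map_id,
          of _ "e ` topspace X"]) (use that d h k in auto)
    then show ?thesis by simp
  qed
  have hk: "h (k z) = z" if "z \<in> topspace K'" for z
  proof -
    have "(h \<circ> k) z = id z"
      by (rule forall_in_closure_of_eq[OF _ H(4) continuous_map_compose[OF k(1) h(1)] continuous_map_id,
          of _ "e' ` topspace X"]) (use that d h k in auto)
    then show ?thesis by simp
  qed
  have maps: "homeomorphic_maps K K' h k"
    using h k kh hk by (simp add: homeomorphic_maps_def)
  have "h z \<notin> e' ` topspace X" if "z \<in> topspace K - e ` topspace X" for z
  proof
    assume "h z \<in> e' ` topspace X"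
    then obtain x where x: "x \<in> topspace X" "h z = e' x" by blast
    then have "z = e x"
      using that k(2)[of x] kh[of z] by simp
    then show False
      using that x by blast
  qed
  moreover have "k z \<notin> e ` topspace X" if "z \<in> topspace K' - e' ` topspace X" for z
  proof
    assume "k z \<in> e ` topspace X"
    then obtain x where x: "x \<in> topspace X" "k z = e x" by blast
    then have "z = e' x"
      using that h(2)[of x] hk[of z] by simp
    then show False
      using that x by blast
  qed
  ultimately have "homeomorphic_maps (remainder X K e) (remainder X K' e') h k"
    unfolding remainder_def using continuous_map_funspace[OF h(1)] continuous_map_funspace[OF k(1)]
    by (intro homeomorphic_maps_subtopologies_alt[OF maps]) auto
  then show ?thesis
    unfolding homeomorphic_space_def by blast
qed

context stone_cech_compactification
begin

lemma component_clopen: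
  assumes "C \<in> connected_components_of X"
  shows "openin X C" "closedin X C"
  using assms locally_connected openin_connected_components_of_locally_connected_space
    closedin_connected_components_of by auto

lemma closure_component_Int_range:
  assumes C: "C \<in> connected_components_of X"
  shows "K closure_of (e ` C) \<inter> e ` topspace X = e ` C"
proof (rule subset_antisym)
  have "openin K (e ` (topspace X - C))"
    using component_clopen[OF C] by (intro open_image) auto
  moreover have "e ` (topspace X - C) \<inter> e ` C = {}"
    using inj_on_image_Int[OF inj_e, of "topspace X - C" C] connected_components_of_subset[OF C] by auto
  ultimately have "e ` (topspace X - C) \<inter> K closure_of (e ` C) = {}"
    by (simp add: openin_Int_closure_of_eq_empty)
  then show "K closure_of (e ` C) \<inter> e ` topspace X \<subseteq> e ` C"
    by blast
  show "e ` C \<subseteq> K closure_of (e ` C) \<inter> e ` topspace X"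
    using closure_of_subset[of "e ` C" K] connected_components_of_subset[OF C] e_in by blast
qed

lemma extend_by_zero:
  assumes C: "C \<in> connected_components_of X" and f: "continuous_map (subtopology X C) euclideanreal f"
  shows "continuous_map X euclideanreal (\<lambda>x. if x \<in> C then f x else 0)"
  unfolding continuous_map
proof (intro conjI allI impI)
  fix V :: "real set" assume "openin euclideanreal V"
  then have "openin (subtopology X C) {x \<in> topspace (subtopology X C). f x \<in> V}"
    by (rule openin_continuous_map_preimage[OF f])
  then have o1: "openin X {x \<in> topspace (subtopology X C). f x \<in> V}"
    using component_clopen(1)[OF C] openin_trans_full by blast
  have o2: "openin X (topspace X - C)"
    using component_clopen(2)[OF C] by blast
  have sub: "C \<subseteq> topspace X"
    by (rule connected_components_of_subset[OF C])
  show "openin X {x \<in> topspace X. (if x \<in> C then f x else 0) \<in> V}"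
  proof (cases "0 \<in> V")
    case True
    then have "{x \<in> topspace X. (if x \<in> C then f x else 0) \<in> V} =
      {x \<in> topspace (subtopology X C). f x \<in> V} \<union> (topspace X - C)"
      using sub by auto
    then show ?thesis
      using o1 o2 by (simp only: openin_Un)
  next
    case False
    then have "{x \<in> topspace X. (if x \<in> C then f x else 0) \<in> V} = {x \<in> topspace (subtopology X C). f x \<in> V}"
      using sub by auto
    then show ?thesis
      using o1 by (simp only:)
  qed
qed simp

lemma open_closure_component:
  assumes C: "C \<in> connected_components_of X"
  shows "openin K (K closure_of (e ` C))"
proof -
  have cont: "continuous_map X euclideanreal (\<lambda>x. if x \<in> C then 1 else 0)"
    by (rule extend_by_zero[OF C]) simp
  have "bounded ((\<lambda>x. if x \<in> C then 1 else 0::real) ` topspace X)"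
    by (rule finite_imp_bounded, rule finite_subset[of _ "{0, 1}"]) auto
  from bounded_extension[OF cont this] obtain g where g: "continuous_map K euclideanreal g"
    "\<And>x. x \<in> topspace X \<Longrightarrow> g (e x) = (if x \<in> C then 1 else 0)"
    by blast
  let ?W = "{z \<in> topspace K. g z \<in> {1/2<..}}"
  have W: "openin K ?W"
    by (rule openin_continuous_map_preimage[OF g(1)]) simp
  have sub: "C \<subseteq> topspace X"
    by (rule connected_components_of_subset[OF C])
  have "?W \<inter> K closure_of (e ` topspace X) \<subseteq> K closure_of (?W \<inter> e ` topspace X)"
    using W by (rule openin_Int_closure_of_subset)
  also have "\<dots> \<subseteq> K closure_of (e ` C)"
    using g(2) by (intro closure_of_mono) (auto split: if_splits)
  finally have "?W \<subseteq> K closure_of (e ` C)"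
    using dense by auto
  moreover have "K closure_of (e ` C) \<subseteq> {z \<in> topspace K. g z \<in> {1..}}"
    using g(2) e_in sub
    by (intro closure_of_minimal closedin_continuous_map_preimage[OF g(1)]) auto
  then have "K closure_of (e ` C) \<subseteq> ?W"
    by auto
  ultimately have "K closure_of (e ` C) = ?W"
    by (rule subset_antisym[rotated])
  then show ?thesis
    using W by (simp only:)
qed

lemma stone_cech_component:
  assumes C: "C \<in> connected_components_of X"
  shows "stone_cech (subtopology X C) (subtopology K (K closure_of (e ` C))) e"
proof -
  have sub: "C \<subseteq> topspace X"
    by (rule connected_components_of_subset[OF C])
  then have top: "topspace (subtopology X C) = C"
    by auto
  have eC: "e ` C \<subseteq> K closure_of (e ` C)"
    using closure_component_Int_range[OF C] by blast
  have "compact_space (subtopology K (K closure_of (e ` C)))"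
    using compact_K by (simp add: closedin_compact_space compact_space_subtopology)
  moreover have "Hausdorff_space (subtopology K (K closure_of (e ` C)))"
    using Hausdorff_K by (rule Hausdorff_space_subtopology)
  moreover have "embedding_map (subtopology X C) K e"
  proof (rule injective_open_imp_embedding_map)
    show "continuous_map (subtopology X C) K e"
      using continuous_e by (rule continuous_map_from_subtopology)
    show "open_map (subtopology X C) K e"
      using open_image component_clopen(1)[OF C]
      by (intro open_map_from_subtopology) (auto simp: open_map_def)
    show "inj_on e (topspace (subtopology X C))"
      using inj_e sub unfolding top by (rule inj_on_subset)
  qed
  then have "embedding_map (subtopology X C) (subtopology K (K closure_of (e ` C))) e"
    using eC by (simp add: embedding_map_in_subtopology top del: topspace_subtopology)
  moreover have "subtopology K (K closure_of (e ` C)) closure_of (e ` topspace (subtopology X C)) =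
      topspace (subtopology K (K closure_of (e ` C)))"
    unfolding top closure_of_subtopology Int_absorb1[OF eC]
    using closure_of_subset_topspace[of K "e ` C"] by auto
  moreover have "\<exists>g. continuous_map (subtopology K (K closure_of (e ` C))) euclideanreal g \<and>
      (\<forall>x\<in>topspace (subtopology X C). g (e x) = f x)"
    if f: "continuous_map (subtopology X C) euclideanreal f" "bounded (f ` topspace (subtopology X C))" for f
  proof -
    have "(\<lambda>x. if x \<in> C then f x else 0) ` topspace X \<subseteq> insert 0 (f ` topspace (subtopology X C))"
      using sub by auto
    then have "bounded ((\<lambda>x. if x \<in> C then f x else 0) ` topspace X)"
      using f(2) bounded_insert bounded_subset by blast
    from bounded_extension[OF extend_by_zero[OF C f(1)] this] obtain g
      where g: "continuous_map K euclideanreal g"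
        "\<And>x. x \<in> topspace X \<Longrightarrow> g (e x) = (if x \<in> C then f x else 0)"
      by blast
    then show ?thesis
      using sub by (intro exI[of _ g]) (auto intro: continuous_map_from_subtopology)
  qed
  ultimately show ?thesis
    unfolding stone_cech_def by blast
qed

lemma remainder_component:
  assumes C: "C \<in> connected_components_of X"
  shows "remainder (subtopology X C) (subtopology K (K closure_of (e ` C))) e =
    subtopology (remainder X K e) (corona C)"
proof -
  have "K closure_of (e ` C) \<subseteq> topspace K"
    by (rule closure_of_subset_topspace)
  moreover have "topspace (subtopology X C) = C"
    using connected_components_of_subset[OF C] by auto
  ultimately have "K closure_of (e ` C) \<inter> (topspace (subtopology K (K closure_of (e ` C))) - e ` topspace (subtopology X C))
    = (topspace K - e ` topspace X) \<inter> corona C"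
    using closure_component_Int_range[OF C] by auto
  then show ?thesis
    unfolding remainder_def subtopology_subtopology by (rule arg_cong)
qed

lemma clopen_family_corona:
  assumes two: "\<And>C. C \<in> connected_components_of X \<Longrightarrow>
    \<exists>a\<in>topspace (remainder (subtopology X C) (subtopology K (K closure_of (e ` C))) e).
    \<exists>b\<in>topspace (remainder (subtopology X C) (subtopology K (K closure_of (e ` C))) e). a \<noteq> b"
  shows "clopen_family (remainder X K e) (connected_components_of X) corona"
proof
  show "t1_space (remainder X K e)"
    unfolding remainder_def using t1_K by (rule t1_space_subtopology)
  fix C assume C: "C \<in> connected_components_of X"
  have eq: "corona C = (topspace K - e ` topspace X) \<inter> K closure_of (e ` C)"
    using closure_of_subset_topspace[of K "e ` C"] by blast
  show "openin (remainder X K e) (corona C)"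
    unfolding remainder_def eq using open_closure_component[OF C] by (rule openin_subtopology_Int2)
  show "closedin (remainder X K e) (corona C)"
    unfolding remainder_def eq closedin_subtopology by (metis Int_commute closedin_closure_of)
  show "\<exists>a\<in>corona C. \<exists>b\<in>corona C. a \<noteq> b"
    using two[OF C] unfolding remainder_component[OF C] by auto
  fix D assume D: "D \<in> connected_components_of X" and "C \<noteq> D"
  then have "C \<inter> D = {}"
    using C connected_components_of_disjoint by (auto simp: disjnt_def)
  then have "e ` C \<inter> e ` D = {}"
    using inj_on_image_Int[OF inj_e, of C D]
      connected_components_of_subset[OF C] connected_components_of_subset[OF D] by simp
  moreover have "K closure_of (e ` C) \<inter> e ` D \<subseteq> e ` C"
    by (rule order_trans[OF Int_mono[OF subset_refl image_mono[OF connected_components_of_subset[OF D]]]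
          equalityD1[OF closure_component_Int_range[OF C]]])
  ultimately have "K closure_of (e ` C) \<inter> e ` D = {}"
    by blast
  then have "K closure_of (e ` C) \<inter> K closure_of (e ` D) = {}"
    using open_closure_component[OF C] by (simp add: openin_Int_closure_of_eq_empty)
  then show "corona C \<inter> corona D = {}"
    by blast
qed

lemma bij_betw_ext:
  assumes i: "i \<in> {7/2, 4, 5}" and X: "sep_Ti i X" and ne: "topspace X \<noteq> {}"
  shows "bij_betw ext L (one_point_connectifications i X)"
  unfolding bij_betw_def
proof
  have closed: "closedin K F" if "F \<in> L" for F
    using that by (simp add: L_iff)
  show "inj_on ext L"
  proof (rule inj_onI)
    fix F G assume FG: "F \<in> L" "G \<in> L" "ext F = ext G"
    then show "F = G"
      using ext_mono[OF closed closed, of F G] ext_mono[OF closed closed, of G F] by auto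
  qed
  show "ext ` L = one_point_connectifications i X"
  proof (intro subset_antisym subsetI)
    fix Y assume "Y \<in> one_point_connectifications i X"
    then show "Y \<in> ext ` L"
      by (rule ext_surj) (rule image_eqI[OF sym])
  qed (use ext_in[OF i X ne] in auto)
qed

lemma conn_le_ext:
  assumes i: "i \<in> {7/2, 4, 5}" and X: "sep_Ti i X" and ne: "topspace X \<noteq> {}"
    and F: "F \<in> L" and G: "G \<in> L"
  shows "conn_le X (ext G) (ext F) \<longleftrightarrow> F \<subseteq> G"
proof -
  have "closedin K F" "closedin K G"
    using F G by (simp_all add: L_iff)
  then show ?thesis
    using conn_le_iff[OF ext_in[OF i X ne G] ext_in[OF i X ne F]] ext_mono by simp
qed

end

theorem theorem3p3:
  fixes i :: real and X :: "'a topology" and X' :: "'b topology"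
  assumes "i \<in> {7/2, 4, 5}"
    and "locally_connected_space X" and "locally_compact_space X" and "sep_Ti i X"
    and "locally_connected_space X'" and "locally_compact_space X'" and "sep_Ti i X'"
    and "\<forall>C\<in>connected_components_of X. \<forall>(K::(('a \<Rightarrow> real) \<Rightarrow> real) topology) e.
           stone_cech (subtopology X C) K e \<longrightarrow>
           (\<exists>a b c. {a, b, c} \<subseteq> topspace (remainder (subtopology X C) K e) \<and>
                    a \<noteq> b \<and> a \<noteq> c \<and> b \<noteq> c)"
    and "\<forall>C'\<in>connected_components_of X'. \<forall>(K'::(('b \<Rightarrow> real) \<Rightarrow> real) topology) e'.
           stone_cech (subtopology X' C') K' e' \<longrightarrow>
           (\<exists>a b c. {a, b, c} \<subseteq> topspace (remainder (subtopology X' C') K' e') \<and>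
                    a \<noteq> b \<and> a \<noteq> c \<and> b \<noteq> c)"
    and "\<exists>\<phi>. bij_betw \<phi> (one_point_connectifications i X) (one_point_connectifications i X') \<and>
              (\<forall>Y1\<in>one_point_connectifications i X. \<forall>Y2\<in>one_point_connectifications i X.
                  conn_le X Y1 Y2 \<longleftrightarrow> conn_le X' (\<phi> Y1) (\<phi> Y2))"
  shows "\<exists>\<psi>. bij_betw \<psi> (connected_components_of X) (connected_components_of X') \<and>
           (\<forall>C\<in>connected_components_of X.
              \<forall>(K::(('a \<Rightarrow> real) \<Rightarrow> real) topology) e (K'::(('b \<Rightarrow> real) \<Rightarrow> real) topology) e'.
                stone_cech (subtopology X C) K e \<and> stone_cech (subtopology X' (\<psi> C)) K' e' \<longrightarrow>
                remainder (subtopology X C) K e homeomorphic_space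
                remainder (subtopology X' (\<psi> C)) K' e')"
proof -
  obtain K :: "(('a \<Rightarrow> real) \<Rightarrow> real) topology" and e where sc: "stone_cech X K e"
    using stone_cech_exists sep_Ti_imp_completely_regular[OF assms(4)] by blast
  obtain K' :: "(('b \<Rightarrow> real) \<Rightarrow> real) topology" and e' where sc': "stone_cech X' K' e'"
    using stone_cech_exists sep_Ti_imp_completely_regular[OF assms(7)] by blast
  interpret S: stone_cech_compactification X K e
    by unfold_locales (fact sc assms(2,3))+
  interpret T: stone_cech_compactification X' K' e'
    by unfold_locales (fact sc' assms(5,6))+
  have clopen: "clopen_family (remainder X K e) (connected_components_of X) S.corona"
  proof (rule S.clopen_family_corona)
    fix C assume C: "C \<in> connected_components_of X"
    let ?R = "remainder (subtopology X C) (subtopology K (K closure_of (e ` C))) e"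
    obtain a b c where "{a, b, c} \<subseteq> topspace ?R" "a \<noteq> b"
      using assms(8)[rule_format, OF C S.stone_cech_component[OF C]] by blast
    then show "\<exists>a\<in>topspace ?R. \<exists>b\<in>topspace ?R. a \<noteq> b"
      by blast
  qed
  have clopen': "clopen_family (remainder X' K' e') (connected_components_of X') T.corona"
  proof (rule T.clopen_family_corona)
    fix C assume C: "C \<in> connected_components_of X'"
    let ?R = "remainder (subtopology X' C) (subtopology K' (K' closure_of (e' ` C))) e'"
    obtain a b c where "{a, b, c} \<subseteq> topspace ?R" "a \<noteq> b"
      using assms(9)[rule_format, OF C T.stone_cech_component[OF C]] by blast
    then show "\<exists>a\<in>topspace ?R. \<exists>b\<in>topspace ?R. a \<noteq> b"
      by blast
  qed
  let ?P = "one_point_connectifications i X" and ?P' = "one_point_connectifications i X'"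
  obtain \<phi> where \<phi>: "bij_betw \<phi> ?P ?P'"
    and mono: "\<And>Y1 Y2. \<lbrakk>Y1 \<in> ?P; Y2 \<in> ?P\<rbrakk> \<Longrightarrow> conn_le X Y1 Y2 \<longleftrightarrow> conn_le X' (\<phi> Y1) (\<phi> Y2)"
    using assms(10) by blast
  have P_empty: "?P = {} \<longleftrightarrow> topspace X = {}"
    using one_point_connectifications_empty S.ext_in[OF assms(1,4) _ clopen_family.topspace_in_L[OF clopen]]
    by blast
  have P'_empty: "?P' = {} \<longleftrightarrow> topspace X' = {}"
    using one_point_connectifications_empty T.ext_in[OF assms(1,7) _ clopen_family.topspace_in_L[OF clopen']]
    by blast
  have "?P = {} \<longleftrightarrow> ?P' = {}"
    using \<phi> by (auto simp: bij_betw_def)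
  then have empty_iff: "topspace X = {} \<longleftrightarrow> topspace X' = {}"
    using P_empty P'_empty by simp
  show ?thesis
  proof (cases "topspace X = {}")
    case True
    then have "connected_components_of X = {}" "connected_components_of X' = {}"
      using empty_iff by (simp_all add: connected_components_of_eq_empty)
    then show ?thesis
      by (simp add: bij_betw_def)
  next
    case False
    then have ne: "topspace X \<noteq> {}" and ne': "topspace X' \<noteq> {}"
      using empty_iff by simp_all
    note ext = S.bij_betw_ext[OF assms(1,4) ne] and ext' = T.bij_betw_ext[OF assms(1,7) ne']
    define \<theta> where "\<theta> = inv_into T.L T.ext \<circ> (\<phi> \<circ> S.ext)"
    have bij: "bij_betw \<theta> S.L T.L"
      unfolding \<theta>_def
      by (intro bij_betw_trans[OF bij_betw_trans[OF ext \<phi>] bij_betw_inv_into[OF ext']])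
    have ext_\<theta>: "T.ext (\<theta> F) = \<phi> (S.ext F)" if "F \<in> S.L" for F
      unfolding \<theta>_def comp_apply
      by (rule bij_betw_inv_into_right[OF ext']) (rule bij_betw_apply[OF \<phi> bij_betw_apply[OF ext that]])
    have "\<theta> F \<subseteq> \<theta> G \<longleftrightarrow> F \<subseteq> G" if F: "F \<in> S.L" and G: "G \<in> S.L" for F G
    proof -
      have "\<theta> F \<subseteq> \<theta> G \<longleftrightarrow> conn_le X' (T.ext (\<theta> G)) (T.ext (\<theta> F))"
        using T.conn_le_ext[OF assms(1,7) ne' bij_betw_apply[OF bij F] bij_betw_apply[OF bij G]] by simp
      also have "\<dots> \<longleftrightarrow> conn_le X (S.ext G) (S.ext F)"
        using mono[OF bij_betw_apply[OF ext G] bij_betw_apply[OF ext F]] by (simp add: ext_\<theta> F G)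
      also have "\<dots> \<longleftrightarrow> F \<subseteq> G"
        by (rule S.conn_le_ext[OF assms(1,4) ne F G])
      finally show ?thesis .
    qed
    then obtain \<psi> where \<psi>: "bij_betw \<psi> (connected_components_of X) (connected_components_of X')"
      and hom: "\<And>C. C \<in> connected_components_of X \<Longrightarrow>
        subtopology (remainder X K e) (S.corona C) homeomorphic_space
        subtopology (remainder X' K' e') (T.corona (\<psi> C))"
      using clopen_family_reconstruction[OF clopen clopen' bij] by metis
    show ?thesis
    proof (intro exI[of _ \<psi>] conjI ballI allI impI \<psi>)
      fix C and K1 :: "(('a \<Rightarrow> real) \<Rightarrow> real) topology" and e1
        and K1' :: "(('b \<Rightarrow> real) \<Rightarrow> real) topology" and e1'
      assume C: "C \<in> connected_components_of X"
        and sc1: "stone_cech (subtopology X C) K1 e1 \<and> stone_cech (subtopology X' (\<psi> C)) K1' e1'"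
      have \<psi>C: "\<psi> C \<in> connected_components_of X'"
        using \<psi> C by (rule bij_betw_apply)
      have "remainder (subtopology X C) K1 e1 homeomorphic_space subtopology (remainder X K e) (S.corona C)"
        using stone_cech_remainder_unique[OF conjunct1[OF sc1] S.stone_cech_component[OF C]]
        unfolding S.remainder_component[OF C] .
      moreover note hom[OF C]
      moreover have "subtopology (remainder X' K' e') (T.corona (\<psi> C)) homeomorphic_space
          remainder (subtopology X' (\<psi> C)) K1' e1'"
        using stone_cech_remainder_unique[OF T.stone_cech_component[OF \<psi>C] conjunct2[OF sc1]]
        unfolding T.remainder_component[OF \<psi>C] .
      ultimately show "remainder (subtopology X C) K1 e1 homeomorphic_space
          remainder (subtopology X' (\<psi> C)) K1' e1'"
        by (meson homeomorphic_space_trans)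
    qed
  qed
qed

end
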